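(* Let $\mathbb T^d=\mathbb R^d/2\pi\mathbb Z^d$, $T>0$, $N\ge1$ a fixed integer, and let $\pi_{0,T}$ be a probability measure on $\mathbb T^d\times\mathbb T^d$ with both marginals equal to $\mathrm{Leb}$ and such that $\mathrm{Ent}(\pi_{0,T})<+\infty$. Then, as $\varepsilon\to0^+$, the functionals $J_{N,\varepsilon}$ $\Gamma$-converge to $J_N$ on $\mathcal P((\mathbb T^d)^{N+1})$ endowed with the weak-$*$ topology, where $$J_N(\gamma):=\int_{(\mathbb T^d)^{N+1}}c_N\,d\gamma+\chi_{\Gamma_N(\pi_{0,T})}(\gamma),\qquad J_{N,\varepsilon}(\gamma):=\varepsilon\,\mathrm H(\gamma\,|\,\theta_{N,\varepsilon})+\chi_{\Gamma_N(\pi_{0,T})}(\gamma).$$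
   Context: $\mathrm{Leb}$ is the Lebesgue measure on $\mathbb T^d$ normalized to be a probability measure; $\mathrm{dist}(x,y)=\inf_{k\in\mathbb Z^d}|x-y+2\pi k|$. For probability measures $q,r$, $\mathrm H(q|r)=\int\log(dq/dr)\,dq$ if $q\ll r$ and $+\infty$ otherwise; for $\mu\in\mathcal P((\mathbb T^d)^m)$, $\mathrm{Ent}(\mu):=\mathrm H(\mu|\mathrm{Leb}^{\otimes m})$. For $\mathbf x_N=(x_0,\dots,x_N)$, $c_N(\mathbf x_N):=\frac{N}{2T}\sum_{k=0}^{N-1}\mathrm{dist}^2(x_{k+1},x_k)$. $\Gamma_N(\pi_{0,T})$ is the set of $\gamma\in\mathcal P((\mathbb T^d)^{N+1})$ whose $k$-th marginal is $\mathrm{Leb}$ for each $k=0,\dots,N$ and whose $(0,N)$ marginal (image under $\mathbf x_N\mapsto(x_0,x_N)$) is $\pi_{0,T}$; $\chi_{\Gamma_N(\pi_{0,T})}$ equals $0$ on $\Gamma_N(\pi_{0,T})$ and $+\infty$ elsewhere. With $p_t(z)=(2\pi t)^{-d/2}\exp(-|z|^2/(2t))$ on $\mathbb R^d$, the heat kernel on $\mathbb T^d$ is $g_t(x):=(2\pi)^d\sum_{k\in\mathbb Z^d}p_t(x+2k\pi)$ for $x\in\mathbb T^d\simeq[-\pi,\pi]^d$, and $\theta_{N,\varepsilon}$ is the probability measure on $(\mathbb T^d)^{N+1}$ with density $\theta_{N,\varepsilon}(x_0,\dots,x_N)=\prod_{k=0}^{N-1}g_{\varepsilon T/N}(x_{k+1}-x_k)$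 with respect to $\mathrm{Leb}^{\otimes(N+1)}$ (equivalently, the law at times $kT/N$, $k=0,\dots,N$, of a stationary Brownian motion on $\mathbb T^d$ with generator $\frac\varepsilon2\Delta$ and uniform initial law). *)

theory Defs
  imports "HOL-Probability.Probability"
begin

text \<open>The torus T^d = R^d / 2 pi Z^d is modelled by its fundamental domain [-pi,pi)^d,
  with points of type real^'d (d = CARD('d)).\<close>

definition torus_box :: "(real^'d) set" where
  "torus_box = {x. \<forall>i. - pi \<le> x $ i \<and> x $ i < pi}"

definition LebT :: "(real^'d) measure" where
  "LebT = uniform_measure (restrict_space lborel torus_box) torus_box"

definition lattice_vec :: "int^'d \<Rightarrow> real^'d" where
  "lattice_vec k = (\<chi> i. 2 * pi * real_of_int (k $ i))"

definition distT :: "real^'d \<Rightarrow> real^'d \<Rightarrow> real" where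
  "distT x y = (INF k::int^'d. norm (x - y + lattice_vec k))"

definition rel_entropy :: "'a measure \<Rightarrow> 'a measure \<Rightarrow> ereal" where
  "rel_entropy q r =
     (if absolutely_continuous r q \<and> sets q = sets r then
        enn2ereal (\<integral>\<^sup>+x. ennreal (ln (enn2real (RN_deriv r q x))) \<partial>q)
        - enn2ereal (\<integral>\<^sup>+x. ennreal (- ln (enn2real (RN_deriv r q x))) \<partial>q)
      else \<infinity>)"

definition LebT_prod :: "nat \<Rightarrow> (nat \<Rightarrow> real^'d) measure" where
  "LebT_prod N = PiM {..N} (\<lambda>_. LebT)"

definition cN :: "nat \<Rightarrow> real \<Rightarrow> (nat \<Rightarrow> real^'d) \<Rightarrow> real" where
  "cN N T x = real N / (2 * T) * (\<Sum>k<N. (distT (x (Suc k)) (x k))\<^sup>2)"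

definition gauss :: "real \<Rightarrow> real^'d \<Rightarrow> real" where
  "gauss t z = (2 * pi * t) powr (- real CARD('d) / 2) * exp (- (norm z)\<^sup>2 / (2 * t))"

definition heat_kernel :: "real \<Rightarrow> real^'d \<Rightarrow> real" where
  "heat_kernel t x = (2 * pi) ^ CARD('d) * (\<Sum>\<^sub>\<infinity>k::int^'d. gauss t (x + lattice_vec k))"

definition theta :: "nat \<Rightarrow> real \<Rightarrow> real \<Rightarrow> (nat \<Rightarrow> real^'d) measure" where
  "theta N T \<epsilon> = density (LebT_prod N)
     (\<lambda>x. ennreal (\<Prod>k<N. heat_kernel (\<epsilon> * T / real N) (x (Suc k) - x k)))"

definition prob_torus :: "nat \<Rightarrow> (nat \<Rightarrow> real^'d) measure set" where
  "prob_torus N = {\<gamma>. prob_space \<gamma> \<and> sets \<gamma> = sets (LebT_prod N)}"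

definition GammaN :: "nat \<Rightarrow> ((real^'d) \<times> (real^'d)) measure \<Rightarrow> (nat \<Rightarrow> real^'d) measure set" where
  "GammaN N \<pi> = {\<gamma> \<in> prob_torus N.
      (\<forall>k\<le>N. distr \<gamma> LebT (\<lambda>x. x k) = LebT) \<and>
      distr \<gamma> (LebT \<Otimes>\<^sub>M LebT) (\<lambda>x. (x 0, x N)) = \<pi>}"

definition chi :: "'a set \<Rightarrow> 'a \<Rightarrow> ereal" where
  "chi A a = (if a \<in> A then 0 else \<infinity>)"

definition JN :: "nat \<Rightarrow> real \<Rightarrow> ((real^'d) \<times> (real^'d)) measure \<Rightarrow> (nat \<Rightarrow> real^'d) measure \<Rightarrow> ereal" where
  "JN N T \<pi> \<gamma> = enn2ereal (\<integral>\<^sup>+x. ennreal (cN N T x) \<partial>\<gamma>) + chi (GammaN N \<pi>) \<gamma>"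

definition JNeps :: "nat \<Rightarrow> real \<Rightarrow> ((real^'d) \<times> (real^'d)) measure \<Rightarrow> real \<Rightarrow> (nat \<Rightarrow> real^'d) measure \<Rightarrow> ereal" where
  "JNeps N T \<pi> \<epsilon> \<gamma> = ereal \<epsilon> * rel_entropy \<gamma> (theta N T \<epsilon>) + chi (GammaN N \<pi>) \<gamma>"

text \<open>Continuous functions on the torus (T^d)^{N+1}: continuous (product topology) functions of
  configurations which are 2 pi Z^d-periodic in every coordinate.\<close>
definition torus_cont :: "((nat \<Rightarrow> real^'d) \<Rightarrow> real) \<Rightarrow> bool" where
  "torus_cont f \<longleftrightarrow> continuous_on UNIV f \<and>
     (\<forall>x k z. f (x(k := x k + lattice_vec z)) = f x)"

definition weak_conv_torus :: "(nat \<Rightarrow> (nat \<Rightarrow> real^'d) measure) \<Rightarrow> (nat \<Rightarrow> real^'d) measure \<Rightarrow> bool" where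
  "weak_conv_torus \<gamma>s \<gamma> \<longleftrightarrow>
     (\<forall>f. torus_cont f \<longrightarrow> (\<lambda>n. \<integral>x. f x \<partial>(\<gamma>s n)) \<longlonglongrightarrow> (\<integral>x. f x \<partial>\<gamma>))"

text \<open>(Sequential) Gamma-convergence, as \<epsilon> \<rightarrow> 0+, of F \<epsilon> to F0 on the set P with the topology
  given by conv (weak-* topology on P((T^d)^{N+1}) is metrizable, so sequential = topological).\<close>
definition gamma_converges ::
  "'a set \<Rightarrow> ((nat \<Rightarrow> 'a) \<Rightarrow> 'a \<Rightarrow> bool) \<Rightarrow> (real \<Rightarrow> 'a \<Rightarrow> ereal) \<Rightarrow> ('a \<Rightarrow> ereal) \<Rightarrow> bool" where
  "gamma_converges P conv F F0 \<longleftrightarrow>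
     (\<forall>e xs x. (\<forall>n. e n > 0) \<and> e \<longlonglongrightarrow> 0 \<and> (\<forall>n. xs n \<in> P) \<and> x \<in> P \<and> conv xs x
        \<longrightarrow> F0 x \<le> liminf (\<lambda>n. F (e n) (xs n))) \<and>
     (\<forall>e x. (\<forall>n. e n > 0) \<and> e \<longlonglongrightarrow> 0 \<and> x \<in> P
        \<longrightarrow> (\<exists>xs. (\<forall>n. xs n \<in> P) \<and> conv xs x \<and> limsup (\<lambda>n. F (e n) (xs n)) \<le> F0 x))"

end

theory Submission
  imports Defs "HOL-Real_Asymp.Real_Asymp"
begin

text \<open>For small \<open>t\<close> the heat kernel lies between \<open>exp (- dist\<^sup>2 / 2t)\<close> and
  \<open>C t\<^bsup>-d/2\<^esup> exp (- dist\<^sup>2 / 2t)\<close>, so \<open>- \<epsilon> ln \<theta>\<^bsub>N,\<epsilon>\<^esub>\<close> converges uniformly to \<open>c\<^sub>N\<close>.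

  Liminf: testing the entropy against \<open>c\<^sub>N / \<epsilon>\<close> gives \<open>\<epsilon> H(\<gamma>|\<theta>) \<ge> \<integral>c\<^sub>N d\<gamma> - o(1)\<close> uniformly in
  \<open>\<gamma>\<close>, and the constraint set is weakly closed.

  Limsup: \<open>\<gamma>\<close> may have infinite entropy. Partition the torus into \<open>m\<^sup>d\<close> equal cubes and
  replace each interior coordinate by a uniform point of its cube. This preserves all marginals
  and \<open>\<pi>\<close>, and the density of the new plan is at most \<open>m\<^bsup>dN\<^esup>\<close> times that of \<open>\<pi>\<close>, so
  its entropy is \<open>O(ln m)\<close>, which is negligible after multiplication by \<open>\<epsilon>\<close> when
  \<open>m \<approx> \<epsilon>\<^bsup>-1/2\<^esup>\<close>.\<close>

subsection \<open>The torus distance\<close>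

text \<open>Two obstacles shape the proof. The constraint prescribes the joint law of the endpoints,
  so only interior coordinates may be smoothed; the absolute continuity of the endpoint law has to
  come from \<open>\<pi>\<close>, which is where its finite entropy enters. Equal cubes are chosen
  because their averaging kernel is symmetric and normalised against \<open>LebT\<close>, hence maps
  a uniform marginal to a uniform marginal. Any m tending to infinity with \<epsilon> ln m
  \<rightarrow> 0 would serve as the number of subdivisions.

  The other obstacle is the model. The torus is a half-open box, which is not compact, while weak
  convergence tests only periodic functions. Boundedness and uniform continuity of test functions
  are therefore obtained on the closed box. Periodic open sets give a coarser topology on the box
  than the Euclidean one, so weak closedness of the constraint requires a proof that they still
  generate all Borel sets, and that periodic continuous functions separate measures.\<close>

lemma lattice_vec_minus: "lattice_vec (- k) = - lattice_vec k"
  by (simp add: lattice_vec_def vec_eq_iff)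

lemma lattice_vec_add: "lattice_vec (k + l) = lattice_vec k + lattice_vec l"
  by (simp add: lattice_vec_def vec_eq_iff algebra_simps)

lemma lattice_vec_0: "lattice_vec 0 = 0"
  by (simp add: lattice_vec_def vec_eq_iff)

lemma range_composition_surj: "surj g \<Longrightarrow> range (\<lambda>x. f (g x)) = range f"
  by (metis image_image)

text \<open>Reindexing by k \<mapsto> -k turns the infimum into a distance to the lattice;
  nonnegativity and continuity are then inherited from \<open>infdist\<close>.\<close>

lemma distT_eq_infdist: "distT x y = infdist (x - y) (range lattice_vec)"
proof -
  have "distT x y = (INF k. norm (x - y + lattice_vec (- k)))"
    unfolding distT_def using range_composition_surj[of uminus "\<lambda>k. norm (x - y + lattice_vec k)"]
    by simp
  then show ?thesis
    by (simp add: infdist_def dist_norm lattice_vec_minus image_image)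
qed

lemma distT_nonneg: "0 \<le> distT x y"
  by (simp add: distT_eq_infdist infdist_nonneg)

lemma distT_le: "distT x y \<le> norm (x - y + lattice_vec k)"
  unfolding distT_def by (rule cINF_lower) (auto intro!: bdd_belowI[of _ 0])

lemma distT_add_lattice_left: "distT (x + lattice_vec z) y = distT x y"
proof -
  have "distT (x + lattice_vec z) y = (INF k. norm (x - y + lattice_vec (z + k)))"
    unfolding distT_def by (simp add: lattice_vec_add algebra_simps)
  also have "\<dots> = distT x y"
    unfolding distT_def using range_composition_surj[of "(+) z" "\<lambda>k. norm (x - y + lattice_vec k)"]
    by (simp add: surj_plus)
  finally show ?thesis .
qed

lemma distT_add_lattice_right: "distT x (y + lattice_vec z) = distT x y"
proof -
  have "distT x (y + lattice_vec z) = distT (x + lattice_vec (- z)) y"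
    unfolding distT_def by (simp add: lattice_vec_minus algebra_simps)
  then show ?thesis
    by (simp add: distT_add_lattice_left)
qed

lemma continuous_on_distT [continuous_intros]:
  assumes "continuous_on S f" "continuous_on S g"
  shows "continuous_on S (\<lambda>x. distT (f x) (g x))"
  unfolding distT_eq_infdist by (intro continuous_intros assms)

subsection \<open>The heat kernel\<close>

text \<open>The nonnegative and the negative integers each contribute at most one full geometric
  series of ratio exp(-1). A bound on finite sums, uniform in F, is all that summability of
  nonnegative terms requires later.\<close>

lemma sum_exp_abs_int_le:
  fixes F :: "int set"
  assumes "finite F"
  shows "(\<Sum>j\<in>F. exp (- \<bar>real_of_int j\<bar>)) \<le> 2 / (1 - exp (- 1 :: real))"
proof -
  let ?r = "exp (- 1 :: real)"
  have geo: "(\<Sum>i\<in>A. ?r ^ i) \<le> 1 / (1 - ?r)" if "finite A" for A :: "nat set"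
  proof -
    have "(\<Sum>i\<in>A. ?r ^ i) \<le> (\<Sum>i. ?r ^ i)"
      using that by (intro sum_le_suminf summable_geometric) auto
    then show ?thesis
      by (simp add: suminf_geometric)
  qed
  have pow: "exp (- real n) = ?r ^ n" for n
    by (simp flip: exp_of_nat_mult)
  let ?P = "F \<inter> {0..}" and ?M = "F \<inter> {..<0}"
  have "(\<Sum>j\<in>?P. exp (- \<bar>real_of_int j\<bar>)) = (\<Sum>i\<in>nat ` ?P. ?r ^ i)"
    by (subst sum.reindex) (auto simp: inj_on_def pow[symmetric])
  moreover have "(\<Sum>j\<in>?M. exp (- \<bar>real_of_int j\<bar>)) = (\<Sum>i\<in>(\<lambda>j. nat (- j)) ` ?M. ?r ^ i)"
    by (subst sum.reindex) (auto simp: inj_on_def pow[symmetric])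
  moreover have "(\<Sum>j\<in>F. exp (- \<bar>real_of_int j\<bar>)) =
      (\<Sum>j\<in>?P. exp (- \<bar>real_of_int j\<bar>)) + (\<Sum>j\<in>?M. exp (- \<bar>real_of_int j\<bar>))"
    using assms by (subst sum.union_disjoint[symmetric]) (auto intro!: sum.cong)
  ultimately show ?thesis
    using geo[of "nat ` ?P"] geo[of "(\<lambda>j. nat (- j)) ` ?M"] assms by simp
qed

lemma norm_sq_vec: "(norm (x :: real^'d))\<^sup>2 = (\<Sum>i\<in>UNIV. (x $ i)\<^sup>2)"
  unfolding norm_vec_def L2_set_def by (simp add: sum_nonneg)

text \<open>One factor from \<open>sum_exp_abs_int_le\<close> per coordinate; the
  \<open>itself\<close> argument carries the dimension.\<close>

definition lattice_sum_bound :: "'d::finite itself \<Rightarrow> real" where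
  "lattice_sum_bound _ = (2 / (1 - exp (- 1))) ^ CARD('d)"

lemma lattice_sum_bound_pos: "0 < lattice_sum_bound TYPE('d::finite)"
  by (simp add: lattice_sum_bound_def)

text \<open>Completing the square in each coordinate reduces the Gaussian lattice sum to a product
  of one-dimensional geometric series.\<close>
lemma sum_gauss_lattice_le:
  fixes x :: "real^'d" and F :: "(int^'d) set"
  assumes F: "finite F"
  shows "(\<Sum>k\<in>F. exp (- (norm (x + lattice_vec k))\<^sup>2 / 2))
    \<le> exp ((norm x)\<^sup>2 / 2) * lattice_sum_bound TYPE('d)"
proof -
  have one: "exp (- (a + 2 * pi * real_of_int j)\<^sup>2 / 2) \<le> exp (a\<^sup>2 / 2) * exp (- \<bar>real_of_int j\<bar>)"
    for a and j :: int
  proof -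
    have j: "\<bar>real_of_int j\<bar> \<le> (real_of_int j)\<^sup>2"
    proof -
      have "\<bar>j\<bar> \<le> j\<^sup>2"
        using self_le_power[of "\<bar>j\<bar>" 2] by (cases "j = 0") auto
      then show ?thesis
        by (metis of_int_abs of_int_le_iff of_int_power)
    qed
    \<comment> \<open>Half of this square is the difference of the two sides of the next
      inequality.\<close>
    have "0 \<le> (2 * a + 2 * pi * real_of_int j)\<^sup>2"
      by simp
    then have "(2 * pi\<^sup>2) * (real_of_int j)\<^sup>2 \<le> (a + 2 * pi * real_of_int j)\<^sup>2 + a\<^sup>2"
      by (simp add: power2_eq_square algebra_simps)
    moreover have "2 * (real_of_int j)\<^sup>2 \<le> (2 * pi\<^sup>2) * (real_of_int j)\<^sup>2"
      using pi_ge_two by (intro mult_right_mono) (auto intro!: one_le_power)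
    ultimately have "2 * \<bar>real_of_int j\<bar> \<le> (a + 2 * pi * real_of_int j)\<^sup>2 + a\<^sup>2"
      using j by linarith
    then show ?thesis
      by (simp flip: exp_add)
  qed
  define e where "e k = exp ((norm x)\<^sup>2 / 2) * (\<Prod>i\<in>UNIV. exp (- \<bar>real_of_int (k i)\<bar>))"
    for k :: "'d \<Rightarrow> int"
  \<comment> \<open>F is enlarged to the product of its coordinate projections, over which the sum
    of products factorises. For this \<open>e\<close> takes functions on the index type instead of
    vectors, as \<open>prod_sum_PiE\<close> expects.\<close>
  define B where "B = (\<lambda>i. (\<lambda>k. k $ i) ` F)"
  have "exp (- (norm (x + lattice_vec k))\<^sup>2 / 2) \<le> e (($) k)" for k
  proof -
    have "exp (- (norm (x + lattice_vec k))\<^sup>2 / 2)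
        = (\<Prod>i\<in>UNIV. exp (- (x $ i + 2 * pi * real_of_int (k $ i))\<^sup>2 / 2))"
      by (simp add: norm_sq_vec lattice_vec_def sum_negf sum_divide_distrib flip: exp_sum)
    also have "\<dots> \<le> (\<Prod>i\<in>UNIV. exp ((x $ i)\<^sup>2 / 2) * exp (- \<bar>real_of_int (k $ i)\<bar>))"
      by (intro prod_mono conjI one) auto
    also have "\<dots> = e (($) k)"
      by (simp add: e_def prod.distrib norm_sq_vec sum_divide_distrib exp_sum)
    finally show ?thesis .
  qed
  then have "(\<Sum>k\<in>F. exp (- (norm (x + lattice_vec k))\<^sup>2 / 2)) \<le> (\<Sum>k\<in>F. e (($) k))"
    by (intro sum_mono)
  also have "\<dots> = (\<Sum>k\<in>($) ` F. e k)"
    by (subst sum.reindex) (auto simp: inj_on_def vec_eq_iff)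
  also have "\<dots> \<le> (\<Sum>k\<in>PiE UNIV B. e k)"
    using F by (intro sum_mono2 finite_PiE) (auto simp: B_def e_def prod_nonneg)
  also have "\<dots> = exp ((norm x)\<^sup>2 / 2) * (\<Prod>i\<in>UNIV. \<Sum>j\<in>B i. exp (- \<bar>real_of_int j\<bar>))"
    using F by (subst prod_sum_PiE) (auto simp: B_def e_def sum_distrib_left)
  also have "\<dots> \<le> exp ((norm x)\<^sup>2 / 2) * (\<Prod>i\<in>(UNIV::'d set). 2 / (1 - exp (- 1)))"
    using F by (intro mult_left_mono prod_mono conjI sum_exp_abs_int_le sum_nonneg) (auto simp: B_def)
  finally show ?thesis
    by (simp add: lattice_sum_bound_def)
qed

text \<open>For \<open>t \<le> 1\<close> the exponents \<open>|x + 2\<pi>k|\<^sup>2 - dist\<^sup>2\<close> are nonnegative, so dividing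
  them by \<open>t\<close> only decreases the terms and the bound at time 1 applies.\<close>
lemma sum_gauss_lattice_scaled_le:
  fixes x y :: "real^'d" and F :: "(int^'d) set"
  assumes F: "finite F" and t: "0 < t" "t \<le> 1"
  shows "(\<Sum>k\<in>F. exp (- (norm (x - y + lattice_vec k))\<^sup>2 / (2 * t)))
    \<le> exp (- (distT x y)\<^sup>2 / (2 * t)) * (exp ((norm (x - y))\<^sup>2) * lattice_sum_bound TYPE('d))"
proof -
  let ?D = "distT x y"
  have term_le: "exp (- (norm (x - y + lattice_vec k))\<^sup>2 / (2 * t))
     \<le> exp (- ?D\<^sup>2 / (2 * t)) * exp (?D\<^sup>2 / 2) * exp (- (norm (x - y + lattice_vec k))\<^sup>2 / 2)" for k
  proof -
    let ?n = "norm (x - y + lattice_vec k)"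
    have "0 \<le> ?n\<^sup>2 - ?D\<^sup>2"
      using distT_le[of x y k] distT_nonneg[of x y] by (simp add: power_mono)
    then have "(?n\<^sup>2 - ?D\<^sup>2) / 2 \<le> (?n\<^sup>2 - ?D\<^sup>2) / (2 * t)"
      using t by (intro divide_left_mono) auto
    then have "- ?n\<^sup>2 / (2 * t) \<le> - ?D\<^sup>2 / (2 * t) + ?D\<^sup>2 / 2 + - ?n\<^sup>2 / 2"
      by (simp add: diff_divide_distrib)
    then show ?thesis
      by (simp flip: exp_add)
  qed
  have "?D \<le> norm (x - y)"
    using distT_le[of x y 0] by (simp add: lattice_vec_0)
  then have D: "exp (?D\<^sup>2 / 2) \<le> exp ((norm (x - y))\<^sup>2 / 2)"
    using distT_nonneg[of x y] by (simp add: power_mono)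
  have "(\<Sum>k\<in>F. exp (- (norm (x - y + lattice_vec k))\<^sup>2 / (2 * t)))
     \<le> exp (- ?D\<^sup>2 / (2 * t)) * exp (?D\<^sup>2 / 2) * (\<Sum>k\<in>F. exp (- (norm (x - y + lattice_vec k))\<^sup>2 / 2))"
    unfolding sum_distrib_left by (intro sum_mono term_le)
  also have "\<dots> \<le> exp (- ?D\<^sup>2 / (2 * t)) * exp ((norm (x - y))\<^sup>2 / 2) *
      (exp ((norm (x - y))\<^sup>2 / 2) * lattice_sum_bound TYPE('d))"
    using D by (intro mult_mono sum_gauss_lattice_le F sum_nonneg) auto
  also have "\<dots> = exp (- ?D\<^sup>2 / (2 * t)) * (exp ((norm (x - y))\<^sup>2) * lattice_sum_bound TYPE('d))"
    by (simp add: mult.assoc mult_exp_exp[of "_ / 2" "_ / 2"] flip: exp_add mult.assoc)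
  finally show ?thesis .
qed

lemma gauss_nonneg: "0 \<le> gauss t z"
  by (simp add: gauss_def)

lemma sum_gauss_le:
  fixes x y :: "real^'d" and F :: "(int^'d) set"
  assumes "finite F" "0 < t" "t \<le> 1"
  shows "(\<Sum>k\<in>F. gauss t (x - y + lattice_vec k))
    \<le> (2 * pi * t) powr (- real CARD('d) / 2) * (exp (- (distT x y)\<^sup>2 / (2 * t)) *
        (exp ((norm (x - y))\<^sup>2) * lattice_sum_bound TYPE('d)))"
  unfolding gauss_def sum_distrib_left[symmetric]
  by (intro mult_left_mono sum_gauss_lattice_scaled_le assms) auto

lemma gauss_lattice_summable:
  fixes x :: "real^'d"
  assumes "0 < t" "t \<le> 1"
  shows "(\<lambda>k. gauss t (x + lattice_vec k)) summable_on UNIV"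
  using sum_gauss_le[OF _ assms, of _ x 0]
  by (intro nonneg_bdd_above_summable_on) (auto simp: bdd_above_def gauss_nonneg)

lemma heat_kernel_upper:
  fixes x y :: "real^'d"
  assumes t: "0 < t" "t \<le> 1"
  shows "heat_kernel t (x - y) \<le> (2 * pi) ^ CARD('d) * ((2 * pi * t) powr (- real CARD('d) / 2) *
    (exp (- (distT x y)\<^sup>2 / (2 * t)) * (exp ((norm (x - y))\<^sup>2) * lattice_sum_bound TYPE('d))))"
  unfolding heat_kernel_def
  by (intro mult_left_mono infsum_le_finite_sums gauss_lattice_summable t sum_gauss_le) auto

lemma heat_kernel_lower:
  fixes x y :: "real^'d"
  assumes t: "0 < t" "t \<le> 1"
  shows "exp (- (distT x y)\<^sup>2 / (2 * t)) \<le> heat_kernel t (x - y)"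
proof -
  let ?d = "real CARD('d)"
  have c: "1 \<le> (2 * pi) ^ CARD('d) * (2 * pi * t) powr (- ?d / 2)"
  proof -
    have "(2 * pi * t) powr (?d / 2) \<le> (2 * pi) powr (?d / 2)"
      using t by (intro powr_mono2) (auto simp: mult_le_cancel_left1)
    also have "\<dots> \<le> (2 * pi) powr ?d"
      using pi_ge_two by (intro powr_mono) auto
    also have "\<dots> = (2 * pi) ^ CARD('d)"
      by (simp add: powr_realpow)
    finally show ?thesis
      using t by (simp add: powr_minus field_simps)
  qed
  have term_le: "exp (- (norm (x - y + lattice_vec k))\<^sup>2 / (2 * t)) \<le> heat_kernel t (x - y)" for k
  proof -
    have "gauss t (x - y + lattice_vec k) = (\<Sum>k\<in>{k}. gauss t (x - y + lattice_vec k))"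
      by simp
    also have "\<dots> \<le> (\<Sum>\<^sub>\<infinity>k. gauss t (x - y + lattice_vec k))"
      by (intro finite_sum_le_infsum gauss_lattice_summable t) (auto simp: gauss_nonneg)
    finally have "(2 * pi) ^ CARD('d) * gauss t (x - y + lattice_vec k) \<le> heat_kernel t (x - y)"
      unfolding heat_kernel_def by (intro mult_left_mono) auto
    moreover have "exp (- (norm (x - y + lattice_vec k))\<^sup>2 / (2 * t))
       \<le> (2 * pi) ^ CARD('d) * gauss t (x - y + lattice_vec k)"
      using mult_right_mono[OF c, of "exp (- (norm (x - y + lattice_vec k))\<^sup>2 / (2 * t))"]
      by (simp add: gauss_def mult.assoc)
    ultimately show ?thesis
      by linarith
  qed
  then have pos: "0 < heat_kernel t (x - y)"
    using less_le_trans[OF exp_gt_zero] by blast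
  \<comment> \<open>Attainment of the infimum in \<open>distT\<close> is avoided: solving the
    termwise bound for the norm gives one number below all norms, hence below \<open>distT\<close>.
    The \<open>max 0\<close> covers kernel values above 1, where the logarithm is positive.\<close>
  define r where "r = sqrt (max 0 (- 2 * t * ln (heat_kernel t (x - y))))"
  have "r \<le> norm (x - y + lattice_vec k)" for k
  proof -
    have "- (norm (x - y + lattice_vec k))\<^sup>2 / (2 * t) \<le> ln (heat_kernel t (x - y))"
      using term_le[of k] pos by (simp add: ln_ge_iff)
    then have "- 2 * t * ln (heat_kernel t (x - y)) \<le> (norm (x - y + lattice_vec k))\<^sup>2"
      using t by (simp add: field_simps)
    then show ?thesis
      unfolding r_def by (intro real_le_lsqrt) auto
  qed
  then have "r \<le> distT x y"
    unfolding distT_def by (intro cINF_greatest) auto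
  then have "r\<^sup>2 \<le> (distT x y)\<^sup>2"
    by (intro power_mono) (auto simp: r_def)
  moreover have "- 2 * t * ln (heat_kernel t (x - y)) \<le> r\<^sup>2"
    by (simp add: r_def)
  ultimately have "- 2 * t * ln (heat_kernel t (x - y)) \<le> (distT x y)\<^sup>2"
    by linarith
  then have "- (distT x y)\<^sup>2 / (2 * t) \<le> ln (heat_kernel t (x - y))"
    using t by (simp add: field_simps)
  then show ?thesis
    using pos by (simp add: ln_ge_iff)
qed

text \<open>A supremum of finite sums of continuous functions is lower semicontinuous.\<close>
lemma borel_measurable_heat_kernel [measurable]:
  assumes t: "0 < t" "t \<le> 1"
  shows "(heat_kernel t :: real^'d \<Rightarrow> real) \<in> borel_measurable borel"
proof -
  define h where "h = (\<lambda>x :: real^'d. \<Sum>\<^sub>\<infinity>k. gauss t (x + lattice_vec k))"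
  have "{x. a < h x} = (\<Union>F\<in>{F. finite F}. {x. a < (\<Sum>k\<in>F. gauss t (x + lattice_vec k))})" for a
  proof (intro set_eqI iffI)
    fix x :: "real^'d" assume "x \<in> {x. a < h x}"
    then have "a < h x" by simp
    show "x \<in> (\<Union>F\<in>{F. finite F}. {x. a < (\<Sum>k\<in>F. gauss t (x + lattice_vec k))})"
    proof (rule ccontr)
      assume "\<not> ?thesis"
      then have "h x \<le> a"
        unfolding h_def by (intro infsum_le_finite_sums gauss_lattice_summable t) (auto simp: not_less)
      with \<open>a < h x\<close> show False by simp
    qed
  next
    fix x :: "real^'d" assume "x \<in> (\<Union>F\<in>{F. finite F}. {x. a < (\<Sum>k\<in>F. gauss t (x + lattice_vec k))})"
    then obtain F where "finite F" "a < (\<Sum>k\<in>F. gauss t (x + lattice_vec k))"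
      by blast
    moreover have "(\<Sum>k\<in>F. gauss t (x + lattice_vec k)) \<le> h x"
      unfolding h_def using \<open>finite F\<close>
      by (intro finite_sum_le_infsum gauss_lattice_summable t) (auto simp: gauss_nonneg)
    ultimately show "x \<in> {x. a < h x}"
      by simp
  qed
  moreover have "open {x :: real^'d. a < (\<Sum>k\<in>F. gauss t (x + lattice_vec k))}" for a F
    unfolding gauss_def using t by (intro open_Collect_less continuous_intros) auto
  ultimately have "open {x. a < h x}" for a
    by auto
  then have "h \<in> borel_measurable borel"
    unfolding borel_measurable_iff_greater by simp
  moreover have "heat_kernel t = (\<lambda>x. (2 * pi) ^ CARD('d) * h x)"
    by (simp add: fun_eq_iff heat_kernel_def h_def)
  ultimately show ?thesis
    by simp
qed

subsection \<open>Uniform measure and continuous functions on the torus\<close>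

lemma half_open_cube_measurable:
  "{x :: real^'d. \<forall>i. a $ i \<le> x $ i \<and> x $ i < b $ i} \<in> sets borel"
proof -
  have "{x :: real^'d. \<forall>i. a $ i \<le> x $ i \<and> x $ i < b $ i} =
      (\<Inter>i\<in>UNIV. {x. a $ i \<le> x $ i} \<inter> {x. x $ i < b $ i})"
    by auto
  also have "\<dots> \<in> sets borel"
    by (intro sets.finite_INT sets.Int borel_closed borel_open closed_Collect_le
        open_Collect_less continuous_intros) auto
  finally show ?thesis .
qed

text \<open>The half-open cube lies between the open and the closed box, which have the same
  volume.\<close>

lemma emeasure_half_open_cube:
  fixes a b :: "real^'d"
  assumes "0 \<le> s" and b: "\<And>i. b $ i = a $ i + s"
  shows "emeasure lborel {x. \<forall>i. a $ i \<le> x $ i \<and> x $ i < b $ i} = ennreal (s ^ CARD('d))"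
    (is "emeasure lborel ?C = _")
proof -
  have *: "(b - a) \<bullet> i = s" if "i \<in> Basis" for i
    using that by (auto simp: Basis_vec_def inner_axis b)
  have le: "a \<bullet> i \<le> b \<bullet> i" if "i \<in> Basis" for i
    using *[OF that] \<open>0 \<le> s\<close> by (simp add: inner_diff_left)
  have "emeasure lborel (cbox a b) = ennreal (s ^ CARD('d))"
    using le * by (subst emeasure_lborel_cbox) auto
  moreover have "emeasure lborel (box a b) = ennreal (s ^ CARD('d))"
    using le * by (subst emeasure_lborel_box) auto
  moreover have "emeasure lborel (box a b) \<le> emeasure lborel ?C"
    using half_open_cube_measurable[of a b]
    by (intro emeasure_mono) (auto simp: mem_box_cart less_imp_le)
  moreover have "emeasure lborel ?C \<le> emeasure lborel (cbox a b)"
    by (intro emeasure_mono) (auto simp: mem_box_cart less_imp_le)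
  ultimately show ?thesis
    by (auto intro: antisym)
qed

lemma torus_box_alt:
  "torus_box = {x :: real^'d. \<forall>i. (\<chi> i. - pi) $ i \<le> x $ i \<and> x $ i < (\<chi> i. pi) $ i}"
  by (simp add: torus_box_def)

lemma torus_box_measurable [measurable]: "(torus_box :: (real^'d) set) \<in> sets borel"
  unfolding torus_box_alt by (rule half_open_cube_measurable)

lemma emeasure_torus_box: "emeasure lborel (torus_box :: (real^'d) set) = ennreal ((2 * pi) ^ CARD('d))"
  unfolding torus_box_alt by (intro emeasure_half_open_cube) auto

lemma space_LebT [simp]: "space LebT = torus_box"
  by (simp add: LebT_def space_restrict_space)

lemma sets_LebT: "sets LebT = sets (restrict_space borel torus_box)"
  by (simp add: LebT_def sets_restrict_space)

lemma prob_space_LebT: "prob_space (LebT :: (real^'d) measure)"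
  unfolding LebT_def
  by (rule prob_space_uniform_measure) (simp_all add: emeasure_restrict_space emeasure_torus_box)

lemma emeasure_LebT:
  assumes "A \<in> sets borel" "A \<subseteq> torus_box"
  shows "emeasure LebT (A :: (real^'d) set) = emeasure lborel A / ennreal ((2 * pi) ^ CARD('d))"
proof -
  have "A \<in> sets (restrict_space lborel torus_box)"
    using assms by (auto simp: sets_restrict_space)
  then show ?thesis
    using assms unfolding LebT_def
    by (subst emeasure_uniform_measure)
      (auto simp: emeasure_restrict_space emeasure_torus_box Int_absorb1 sets_restrict_space)
qed

interpretation LebT: prob_space LebT
  by (rule prob_space_LebT)

interpretation LebT_PiM: product_prob_space "\<lambda>_ :: nat. LebT" "{..N}" for N
  by unfold_locales

lemma prob_space_LebT_prod: "prob_space (LebT_prod N)"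
  unfolding LebT_prod_def by (rule prob_space_PiM) (rule prob_space_LebT)

lemma space_LebT_prod: "space (LebT_prod N) = PiE {..N} (\<lambda>_. torus_box)"
  by (simp add: LebT_prod_def space_PiM)

lemma measurable_LebT_borel: "f \<in> measurable LebT borel" if "f \<in> borel_measurable borel"
  using that measurable_restrict_space1 by (simp cong: measurable_cong_sets add: sets_LebT)

lemma measurable_component_LebT_prod [measurable]:
  "k \<le> N \<Longrightarrow> (\<lambda>x. x k) \<in> measurable (LebT_prod N) LebT"
  unfolding LebT_prod_def by (rule measurable_component_singleton) simp

text \<open>Beyond N the coordinate is the constant \<open>undefined\<close> on the extensional
  product. These coordinates matter because test functions in \<open>torus_cont\<close> live on full
  sequences.\<close>

lemma measurable_component_LebT_prod_borel:
  "(\<lambda>x. x k) \<in> borel_measurable (LebT_prod N :: (nat \<Rightarrow> real^'d) measure)"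
proof (cases "k \<le> N")
  case True
  then show ?thesis
    using measurable_compose[OF measurable_component_LebT_prod[OF True]
        measurable_LebT_borel[of "\<lambda>x. x"]] by simp
next
  case False
  then have "(\<lambda>x. x k) \<in> borel_measurable (LebT_prod N :: (nat \<Rightarrow> real^'d) measure) \<longleftrightarrow>
      (\<lambda>x. undefined :: real^'d) \<in> borel_measurable (LebT_prod N :: (nat \<Rightarrow> real^'d) measure)"
    by (intro measurable_cong) (auto simp: space_LebT_prod PiE_def extensional_def)
  then show ?thesis by simp
qed

lemma measurable_LebT_prod_borel:
  "(\<lambda>x. x) \<in> measurable (LebT_prod N) (borel :: (nat \<Rightarrow> real^'d) measure)"
proof -
  have "(\<lambda>x. x) \<in> measurable (LebT_prod N) (PiM UNIV (\<lambda>_. borel :: (real^'d) measure))"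
    by (rule measurable_PiM_single') (auto intro: measurable_component_LebT_prod_borel)
  then show ?thesis
    by (simp cong: measurable_cong_sets add: sets_PiM_equal_borel)
qed

lemma measurable_torus_cont:
  assumes "torus_cont (f :: (nat \<Rightarrow> real^'d) \<Rightarrow> real)"
  shows "f \<in> borel_measurable (LebT_prod N)"
proof -
  have "f \<in> borel_measurable borel"
    using assms by (intro borel_measurable_continuous_onI) (simp add: torus_cont_def)
  from measurable_compose[OF measurable_LebT_prod_borel this] show ?thesis .
qed

text \<open>A compact set containing all configurations; the singletons \<open>{undefined}\<close>
  match the extensional padding beyond N.\<close>

definition closed_box_prod :: "nat \<Rightarrow> (nat \<Rightarrow> real^'d) set" where
  "closed_box_prod N =
    PiE UNIV (\<lambda>i. if i \<le> N then cbox (\<chi> i. - pi) (\<chi> i. pi) else {undefined})"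

lemma compact_closed_box_prod: "compact (closed_box_prod N)"
proof -
  have "compactin (product_topology (\<lambda>_. euclidean) UNIV) (closed_box_prod N :: (nat \<Rightarrow> real^'d) set)"
    unfolding closed_box_prod_def compactin_PiE by auto
  then show ?thesis
    by (simp add: euclidean_product_topology)
qed

lemma space_subset_closed_box_prod: "space (LebT_prod N) \<subseteq> closed_box_prod N"
  by (auto simp: space_LebT_prod closed_box_prod_def PiE_def Pi_def extensional_def mem_box_cart
      torus_box_def less_imp_le)

lemma torus_cont_bounded:
  assumes "torus_cont f"
  obtains B where "0 \<le> B" "\<And>x. x \<in> space (LebT_prod N) \<Longrightarrow> \<bar>f x\<bar> \<le> B"
proof -
  have "continuous_on (closed_box_prod N) f"
    using assms continuous_on_subset[of UNIV f] by (simp add: torus_cont_def)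
  then have "compact (f ` closed_box_prod N)"
    by (intro compact_continuous_image compact_closed_box_prod)
  then obtain B where "\<And>y. y \<in> f ` closed_box_prod N \<Longrightarrow> \<bar>y\<bar> \<le> B"
    using compact_imp_bounded[of "f ` closed_box_prod N"] unfolding bounded_iff real_norm_def by blast
  then have "\<bar>f x\<bar> \<le> B" if "x \<in> space (LebT_prod N)" for x
    using that space_subset_closed_box_prod[of N] by blast
  then show ?thesis
    by (intro that[of "max B 0"]) (auto intro: order_trans[OF _ max.cobounded1])
qed

lemma torus_cont_integrable:
  assumes "torus_cont f" "\<gamma> \<in> prob_torus N"
  shows "integrable \<gamma> f"
proof -
  have sets: "sets \<gamma> = sets (LebT_prod N)" and "prob_space \<gamma>"
    using assms by (auto simp: prob_torus_def)
  interpret prob_space \<gamma> by fact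
  obtain B where "\<And>x. x \<in> space (LebT_prod N) \<Longrightarrow> \<bar>f x\<bar> \<le> B"
    using torus_cont_bounded[OF assms(1)] by metis
  then show ?thesis
    using measurable_torus_cont[OF assms(1), of N] sets_eq_imp_space_eq[OF sets]
    by (intro integrable_const_bound[where B = B])
      (auto cong: measurable_cong_sets simp: sets)
qed

text \<open>The metric on sequences is a sum of truncated distances with weights 2^(-n), whose total
  is 2.\<close>

lemma dist_fun_le:
  fixes x y :: "nat \<Rightarrow> 'a::metric_space"
  assumes "\<And>i. dist (x i) (y i) \<le> \<delta>"
  shows "dist x y \<le> 2 * \<delta>"
proof -
  have s: "summable (\<lambda>n. (1 / 2) ^ n * \<delta>)"
    by (intro summable_mult2 summable_geometric) simp
  have "dist x y = (\<Sum>n. (1 / 2) ^ n * min (dist (x (from_nat n)) (y (from_nat n))) 1)"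
    by (simp add: dist_fun_def)
  also have "\<dots> \<le> (\<Sum>n. (1 / 2) ^ n * \<delta>)"
  proof (rule suminf_le[OF _ _ s])
    show "summable (\<lambda>n. (1 / 2) ^ n * min (dist (x (from_nat n)) (y (from_nat n))) 1 :: real)"
      by (rule summable_comparison_test'[OF summable_geometric[of "1/2"], of 0]) 
        (auto simp: abs_mult mult_le_cancel_left1)
  qed (use assms in \<open>auto intro!: mult_left_mono min.coboundedI1\<close>)
  also have "\<dots> = 2 * \<delta>"
    by (subst suminf_mult2[symmetric]) (auto simp: suminf_geometric summable_geometric)
  finally show ?thesis .
qed

lemma torus_cont_uniformly:
  assumes "torus_cont (f :: (nat \<Rightarrow> real^'d) \<Rightarrow> real)" "0 < \<epsilon>"
  obtains \<delta> where "0 < \<delta>"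
    "\<And>x y. x \<in> space (LebT_prod N) \<Longrightarrow> y \<in> space (LebT_prod N) \<Longrightarrow>
      (\<And>i. dist (x i) (y i) \<le> \<delta>) \<Longrightarrow> \<bar>f x - f y\<bar> \<le> \<epsilon>"
proof -
  have "continuous_on (closed_box_prod N) f"
    using assms continuous_on_subset[of UNIV f] by (simp add: torus_cont_def)
  then have "uniformly_continuous_on (closed_box_prod N) f"
    by (intro compact_uniformly_continuous compact_closed_box_prod)
  then obtain \<delta> where "0 < \<delta>"
    and \<delta>: "\<And>x y. x \<in> closed_box_prod N \<Longrightarrow> y \<in> closed_box_prod N \<Longrightarrow> dist y x < \<delta> \<Longrightarrow> dist (f y) (f x) < \<epsilon>"
    using \<open>0 < \<epsilon>\<close> unfolding uniformly_continuous_on_def by metis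
  \<comment> \<open>Passing from coordinates to the sequence metric costs a factor 2, and uniform
    continuity asks for a strict inequality; hence a third of \<open>\<delta>\<close>.\<close>
  show ?thesis
  proof (rule that[of "\<delta> / 3"])
    fix x y :: "nat \<Rightarrow> real^'d" assume xy: "x \<in> space (LebT_prod N)" "y \<in> space (LebT_prod N)"
      and d: "\<And>i. dist (x i) (y i) \<le> \<delta> / 3"
    have "dist x y < \<delta>"
      using dist_fun_le[of x y, OF d] \<open>0 < \<delta>\<close> by linarith
    moreover have "x \<in> closed_box_prod N" "y \<in> closed_box_prod N"
      using xy space_subset_closed_box_prod[of N] by blast+
    ultimately show "\<bar>f x - f y\<bar> \<le> \<epsilon>"
      using \<delta>[of y x] by (simp add: dist_real_def)
  qed (use \<open>0 < \<delta>\<close> in auto)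
qed

lemma cN_torus_cont: "torus_cont (cN N T :: (nat \<Rightarrow> real^'d) \<Rightarrow> real)"
  unfolding torus_cont_def
proof (intro conjI allI)
  show "continuous_on UNIV (cN N T :: (nat \<Rightarrow> real^'d) \<Rightarrow> real)"
    unfolding cN_def[abs_def] by (intro continuous_intros continuous_on_product_coordinates)
  show "cN N T (x(k := x k + lattice_vec z)) = cN N T x" for x :: "nat \<Rightarrow> real^'d" and k z
    unfolding cN_def
    by (intro arg_cong2[where f = "(*)"] sum.cong refl)
      (auto simp: distT_add_lattice_left distT_add_lattice_right)
qed

lemma cN_nonneg: "0 < T \<Longrightarrow> 0 \<le> cN N T x"
  by (simp add: cN_def sum_nonneg)

lemma nn_integral_cN:
  assumes "0 < T" "\<gamma> \<in> prob_torus N"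
  shows "(\<integral>\<^sup>+x. ennreal (cN N T x) \<partial>\<gamma>) = ennreal (\<integral>x. cN N T x \<partial>\<gamma>)"
  using assms by (intro nn_integral_eq_integral torus_cont_integrable cN_torus_cont)
    (auto simp: cN_nonneg)

subsection \<open>Lower bound for the entropy\<close>

text \<open>The easy half of the Donsker--Varadhan formula, from \<open>ln w \<le> w - 1\<close> with
  \<open>w = exp \<phi> / (K f)\<close> where \<open>f\<close> is the density of \<open>\<gamma>\<close>. The reference measure need not be normalised.\<close>
lemma rel_entropy_ge:
  fixes \<gamma> \<theta> :: "'a measure" and \<phi> :: "'a \<Rightarrow> real"
  assumes "finite_measure \<theta>" "prob_space \<gamma>"
    and \<phi>: "\<phi> \<in> borel_measurable \<theta>" "\<And>x. x \<in> space \<theta> \<Longrightarrow> 0 \<le> \<phi> x" "\<And>x. x \<in> space \<theta> \<Longrightarrow> \<phi> x \<le> B"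
    and K: "0 < K" "(\<integral>\<^sup>+x. ennreal (exp (\<phi> x)) \<partial>\<theta>) \<le> ennreal K"
  shows "ereal ((\<integral>x. \<phi> x \<partial>\<gamma>) - ln K) \<le> rel_entropy \<gamma> \<theta>"
proof (cases "absolutely_continuous \<theta> \<gamma> \<and> sets \<gamma> = sets \<theta>")
  case False
  then show ?thesis
    by (auto simp: rel_entropy_def)
next
  case True
  then have ac: "absolutely_continuous \<theta> \<gamma>" and sets: "sets \<gamma> = sets \<theta>"
    by auto
  have space: "space \<gamma> = space \<theta>"
    using sets by (rule sets_eq_imp_space_eq)
  interpret \<theta>: finite_measure \<theta> by fact
  interpret \<gamma>: prob_space \<gamma> by fact
  define f where "f x = enn2real (RN_deriv \<theta> \<gamma> x)" for x
  have f[measurable]: "f \<in> borel_measurable \<theta>"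
    by (simp add: f_def[abs_def])
  note \<phi>(1)[measurable]
  have f_nonneg: "0 \<le> f x" for x
    by (simp add: f_def)
  have "AE x in \<theta>. RN_deriv \<theta> \<gamma> x \<noteq> \<infinity>"
    using \<theta>.RN_deriv_finite[OF _ ac sets] \<gamma>.sigma_finite_measure_axioms by simp
  then have "density \<theta> (RN_deriv \<theta> \<gamma>) = density \<theta> (\<lambda>x. ennreal (f x))"
    by (intro density_cong) (auto simp: f_def less_top)
  then have \<gamma>: "\<gamma> = density \<theta> (\<lambda>x. ennreal (f x))"
    using \<theta>.density_RN_deriv[OF ac sets] by simp
  have f_pos: "AE x in \<gamma>. 0 < f x"
    by (subst \<gamma>) (simp add: AE_density)
  define w where "w x = exp (\<phi> x) / (f x * K)" for x
  have f\<gamma>[measurable]: "f \<in> borel_measurable \<gamma>" and \<phi>\<gamma>[measurable]: "\<phi> \<in> borel_measurable \<gamma>"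
    using f \<phi>(1) by (simp_all cong: measurable_cong_sets add: sets)
  have w[measurable]: "w \<in> borel_measurable \<theta>" and w\<gamma>[measurable]: "w \<in> borel_measurable \<gamma>"
    unfolding w_def[abs_def] by measurable
  have w_nonneg: "0 \<le> w x" for x
    using K f_nonneg[of x] by (simp add: w_def)
  have "(\<integral>\<^sup>+x. ennreal (w x) \<partial>\<gamma>) = (\<integral>\<^sup>+x. ennreal (f x) * ennreal (w x) \<partial>\<theta>)"
    by (subst \<gamma>) (simp add: nn_integral_density)
  also have "\<dots> \<le> (\<integral>\<^sup>+x. ennreal (exp (\<phi> x)) * ennreal (1 / K) \<partial>\<theta>)"
  proof (intro nn_integral_mono)
    fix x
    \<comment> \<open>Equality where \<open>f x\<close> is nonzero; where \<open>f x = 0\<close>,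
      division by zero makes \<open>w x = 0\<close> and the left side vanishes.\<close>
    have "f x * w x \<le> exp (\<phi> x) * (1 / K)"
      using K f_nonneg[of x] by (cases "f x = 0") (auto simp: w_def)
    then show "ennreal (f x) * ennreal (w x) \<le> ennreal (exp (\<phi> x)) * ennreal (1 / K)"
      using f_nonneg[of x] w_nonneg[of x] K by (simp add: ennreal_mult[symmetric] ennreal_leI)
  qed
  also have "\<dots> = (\<integral>\<^sup>+x. ennreal (exp (\<phi> x)) \<partial>\<theta>) * ennreal (1 / K)"
    by (rule nn_integral_multc) measurable
  also have "\<dots> \<le> ennreal K * ennreal (1 / K)"
    by (intro mult_right_mono K) simp
  also have "\<dots> = 1"
    using K by (simp add: ennreal_mult[symmetric])
  finally have w_le: "(\<integral>\<^sup>+x. ennreal (w x) \<partial>\<gamma>) \<le> 1" .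
  then have w_int: "integrable \<gamma> w"
    by (intro integrableI_bounded)
      (auto simp: w_nonneg less_top intro: le_less_trans)
  have "ennreal (\<integral>x. w x \<partial>\<gamma>) \<le> 1"
    using w_le by (simp add: nn_integral_eq_integral[OF w_int] w_nonneg)
  then have w_int_le: "(\<integral>x. w x \<partial>\<gamma>) \<le> 1"
    by (simp add: ennreal_le_1)
  have key: "AE x in \<gamma>. \<phi> x - ln (f x) - ln K \<le> w x - 1"
    using f_pos
  proof eventually_elim
    case (elim x)
    then have "ln (w x) \<le> w x - 1"
      using K by (intro ln_le_minus_one) (simp add: w_def)
    then show ?case
      using elim K by (simp add: w_def ln_div ln_mult)
  qed
  \<comment> \<open>This excludes the value -\<infinity> and makes ln f integrable as soon as its
    positive part is. By \<open>key\<close> and \<phi> \<ge> 0, -ln f is at most w + |ln K|, which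
    is integrable.\<close>
  have neg: "(\<integral>\<^sup>+x. ennreal (- ln (f x)) \<partial>\<gamma>) < \<infinity>"
  proof -
    have "AE x in \<gamma>. \<phi> x \<ge> 0"
      using \<phi>(2) by (auto simp: space)
    with key have "AE x in \<gamma>. ennreal (- ln (f x)) \<le> ennreal (w x + \<bar>ln K\<bar>)"
      by eventually_elim (intro ennreal_leI, linarith)
    then have "(\<integral>\<^sup>+x. ennreal (- ln (f x)) \<partial>\<gamma>) \<le> (\<integral>\<^sup>+x. ennreal (w x + \<bar>ln K\<bar>) \<partial>\<gamma>)"
      by (rule nn_integral_mono_AE)
    also have "\<dots> = ennreal (\<integral>x. w x + \<bar>ln K\<bar> \<partial>\<gamma>)"
      using w_int by (intro nn_integral_eq_integral) (auto simp: w_nonneg)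
    finally show ?thesis
      by (simp add: le_less_trans)
  qed
  have ent: "rel_entropy \<gamma> \<theta> = enn2ereal (\<integral>\<^sup>+x. ennreal (ln (f x)) \<partial>\<gamma>)
      - enn2ereal (\<integral>\<^sup>+x. ennreal (- ln (f x)) \<partial>\<gamma>)"
    using True by (simp add: rel_entropy_def f_def)
  show ?thesis
  proof (cases "(\<integral>\<^sup>+x. ennreal (ln (f x)) \<partial>\<gamma>) = \<infinity>")
    case True
    then show ?thesis
      by (simp add: ent)
  next
    case False
    then have int: "integrable \<gamma> (\<lambda>x. ln (f x))"
      using neg by (auto simp: real_integrable_def)
    have "rel_entropy \<gamma> \<theta> = ereal (\<integral>x. ln (f x) \<partial>\<gamma>)"
      using False neg by (simp add: ent real_lebesgue_integral_def[OF int] less_top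
          enn2ereal_ennreal flip: ereal_minus) (metis enn2ereal_ennreal enn2real_nonneg ennreal_enn2real less_top)
    moreover have \<phi>_int: "integrable \<gamma> \<phi>"
      using \<phi> by (intro \<gamma>.integrable_const_bound[where B = B]) (auto simp: space)
    have "(\<integral>x. \<phi> x - ln (f x) - ln K \<partial>\<gamma>) \<le> (\<integral>x. w x - 1 \<partial>\<gamma>)"
      using key by (intro integral_mono_AE) (auto intro!: Bochner_Integration.integrable_diff \<phi>_int int w_int)
    then have "(\<integral>x. \<phi> x \<partial>\<gamma>) - (\<integral>x. ln (f x) \<partial>\<gamma>) - ln K \<le> (\<integral>x. w x \<partial>\<gamma>) - 1"
      using \<phi>_int int w_int by (simp add: \<gamma>.prob_space)
    ultimately show ?thesis
      using w_int_le by simp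
  qed
qed

section \<open>Exponential moments of the cost under the heat-kernel measure\<close>

definition heat_const :: "'d::finite itself \<Rightarrow> real \<Rightarrow> real" where
  "heat_const _ t = (2 * pi) ^ CARD('d) * ((2 * pi * t) powr (- real CARD('d) / 2) *
     (exp (real CARD('d) * (2 * pi)\<^sup>2) * lattice_sum_bound TYPE('d)))"

lemma heat_const_pos: "0 < t \<Longrightarrow> 0 < heat_const TYPE('d::finite) t"
  by (simp add: heat_const_def lattice_sum_bound_pos)

text \<open>Each coordinate of a difference of box points is at most 2 pi in absolute value; this is
  the origin of the exponent d (2 pi)^2 in \<open>heat_const\<close>.\<close>

lemma heat_kernel_upper_box:
  fixes x y :: "real^'d"
  assumes t: "0 < t" "t \<le> 1" and "x \<in> torus_box" "y \<in> torus_box"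
  shows "heat_kernel t (x - y) \<le> heat_const TYPE('d) t * exp (- (distT x y)\<^sup>2 / (2 * t))"
proof -
  have "(norm (x - y))\<^sup>2 \<le> (\<Sum>i\<in>(UNIV :: 'd set). (2 * pi)\<^sup>2)"
    unfolding norm_sq_vec
  proof (rule sum_mono)
    fix i
    have "- pi \<le> x $ i" "x $ i < pi" "- pi \<le> y $ i" "y $ i < pi"
      using assms by (auto simp: torus_box_def)
    then have "\<bar>(x - y) $ i\<bar> \<le> \<bar>2 * pi\<bar>"
      by simp
    then show "((x - y) $ i)\<^sup>2 \<le> (2 * pi)\<^sup>2"
      by (simp only: abs_le_square_iff)
  qed
  then have "exp ((norm (x - y))\<^sup>2) \<le> exp (real CARD('d) * (2 * pi)\<^sup>2)"
    by simp
  then have "(2 * pi) ^ CARD('d) * ((2 * pi * t) powr (- real CARD('d) / 2) *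
    (exp (- (distT x y)\<^sup>2 / (2 * t)) * (exp ((norm (x - y))\<^sup>2) * lattice_sum_bound TYPE('d))))
    \<le> (2 * pi) ^ CARD('d) * ((2 * pi * t) powr (- real CARD('d) / 2) *
    (exp (- (distT x y)\<^sup>2 / (2 * t)) * (exp (real CARD('d) * (2 * pi)\<^sup>2) * lattice_sum_bound TYPE('d))))"
    using lattice_sum_bound_pos[where 'd = 'd]
    by (intro mult_left_mono mult_right_mono) auto
  then show ?thesis
    using heat_kernel_upper[OF t, of x y] by (simp add: heat_const_def ac_simps)
qed

definition theta_dens :: "nat \<Rightarrow> real \<Rightarrow> real \<Rightarrow> (nat \<Rightarrow> real^'d) \<Rightarrow> real" where
  "theta_dens N T \<epsilon> x = (\<Prod>k<N. heat_kernel (\<epsilon> * T / real N) (x (Suc k) - x k))"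

lemma theta_alt: "theta N T \<epsilon> = density (LebT_prod N) (\<lambda>x. ennreal (theta_dens N T \<epsilon> x))"
  by (simp add: theta_def theta_dens_def)

lemma exp_cN:
  assumes "0 < \<epsilon>" "0 < T" "1 \<le> N"
  shows "exp (- cN N T x / \<epsilon>) = (\<Prod>k<N. exp (- (distT (x (Suc k)) (x k))\<^sup>2 / (2 * (\<epsilon> * T / real N))))"
proof -
  have "- cN N T x / \<epsilon> = (\<Sum>k<N. - (distT (x (Suc k)) (x k))\<^sup>2 / (2 * (\<epsilon> * T / real N)))"
    using assms by (simp add: cN_def sum_divide_distrib sum_distrib_left sum_negf field_simps)
  then show ?thesis
    by (simp add: exp_sum)
qed

lemma theta_dens_upper:
  fixes x :: "nat \<Rightarrow> real^'d"
  assumes "0 < \<epsilon>" "0 < T" "1 \<le> N" "\<epsilon> * T / real N \<le> 1" "x \<in> space (LebT_prod N)"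
  shows "theta_dens N T \<epsilon> x \<le> heat_const TYPE('d) (\<epsilon> * T / real N) ^ N * exp (- cN N T x / \<epsilon>)"
proof -
  let ?t = "\<epsilon> * T / real N"
  have t: "0 < ?t" using assms by simp
  have box: "x k \<in> torus_box" if "k \<le> N" for k
    using assms that by (auto simp: space_LebT_prod)
  have "theta_dens N T \<epsilon> x \<le>
      (\<Prod>k<N. heat_const TYPE('d) ?t * exp (- (distT (x (Suc k)) (x k))\<^sup>2 / (2 * ?t)))"
    unfolding theta_dens_def
    by (intro prod_mono conjI heat_kernel_upper_box t assms box
        order_trans[OF exp_ge_zero heat_kernel_lower]) auto
  then show ?thesis
    unfolding exp_cN[OF assms(1-3)] by (simp add: prod.distrib)
qed

lemma theta_dens_lower:
  fixes x :: "nat \<Rightarrow> real^'d"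
  assumes "0 < \<epsilon>" "0 < T" "1 \<le> N" "\<epsilon> * T / real N \<le> 1"
  shows "exp (- cN N T x / \<epsilon>) \<le> theta_dens N T \<epsilon> x"
  unfolding exp_cN[OF assms(1-3)] theta_dens_def
  using assms by (intro prod_mono conjI heat_kernel_lower) auto

lemma theta_dens_measurable:
  assumes "0 < \<epsilon>" "0 < T" "1 \<le> N" "\<epsilon> * T / real N \<le> 1"
  shows "theta_dens N T \<epsilon> \<in> borel_measurable (LebT_prod N :: (nat \<Rightarrow> real^'d) measure)"
proof -
  note measurable_component_LebT_prod_borel[measurable]
  have [measurable]: "(heat_kernel (\<epsilon> * T / real N) :: real^'d \<Rightarrow> real) \<in> borel_measurable borel"
    using assms by (intro borel_measurable_heat_kernel) auto
  show ?thesis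
    unfolding theta_dens_def[abs_def] by measurable
qed

lemma sets_theta [simp]: "sets (theta N T \<epsilon>) = sets (LebT_prod N)"
  by (simp add: theta_def)

lemma space_theta [simp]: "space (theta N T \<epsilon>) = space (LebT_prod N)"
  by (simp add: theta_def)

text \<open>The weight exp(c_N / \<epsilon>) exactly cancels the exponential factor in
  \<open>theta_dens_upper\<close>, leaving a constant integrated against a probability measure. This
  is the moment hypothesis of \<open>rel_entropy_ge\<close>.\<close>

lemma nn_integral_exp_cN_theta:
  assumes "0 < \<epsilon>" "0 < T" "1 \<le> N" "\<epsilon> * T / real N \<le> 1"
  shows "(\<integral>\<^sup>+x. ennreal (exp (cN N T x / \<epsilon>)) \<partial>(theta N T \<epsilon> :: (nat \<Rightarrow> real^'d) measure))
    \<le> ennreal (heat_const TYPE('d) (\<epsilon> * T / real N) ^ N)" (is "_ \<le> ennreal ?K")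
proof -
  interpret L: prob_space "LebT_prod N :: (nat \<Rightarrow> real^'d) measure"
    by (rule prob_space_LebT_prod)
  note theta_dens_measurable[OF assms, measurable] measurable_torus_cont[OF cN_torus_cont, measurable]
  have pos: "0 < heat_const TYPE('d) (\<epsilon> * T / real N)"
    using assms by (intro heat_const_pos) auto
  have "(\<integral>\<^sup>+x. ennreal (exp (cN N T x / \<epsilon>)) \<partial>(theta N T \<epsilon> :: (nat \<Rightarrow> real^'d) measure))
    = (\<integral>\<^sup>+x. ennreal (theta_dens N T \<epsilon> x) * ennreal (exp (cN N T x / \<epsilon>)) \<partial>(LebT_prod N :: (nat \<Rightarrow> real^'d) measure))"
    unfolding theta_alt by (rule nn_integral_density) measurable
  also have "\<dots> \<le> (\<integral>\<^sup>+x. ennreal ?K \<partial>(LebT_prod N :: (nat \<Rightarrow> real^'d) measure))"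
  proof (intro nn_integral_mono)
    fix x :: "nat \<Rightarrow> real^'d" assume x: "x \<in> space (LebT_prod N)"
    have "theta_dens N T \<epsilon> x * exp (cN N T x / \<epsilon>) \<le> ?K * exp (- cN N T x / \<epsilon>) * exp (cN N T x / \<epsilon>)"
      using theta_dens_upper[OF assms x] by (intro mult_right_mono) auto
    also have "\<dots> = ?K"
      by (simp add: mult.assoc flip: exp_add)
    finally show "ennreal (theta_dens N T \<epsilon> x) * ennreal (exp (cN N T x / \<epsilon>)) \<le> ennreal ?K"
      using order_trans[OF exp_ge_zero theta_dens_lower[OF assms, of x]]
      by (simp add: ennreal_mult[symmetric] ennreal_leI)
  qed
  also have "\<dots> = ennreal ?K"
    by (simp add: L.emeasure_space_1)
  finally show ?thesis .
qed

text \<open>Since c_N \<ge> 0, the exponential moment just bounded dominates the total mass.\<close>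

lemma finite_measure_theta:
  assumes "0 < \<epsilon>" "0 < T" "1 \<le> N" "\<epsilon> * T / real N \<le> 1"
  shows "finite_measure (theta N T \<epsilon> :: (nat \<Rightarrow> real^'d) measure)"
proof
  have "emeasure (theta N T \<epsilon> :: (nat \<Rightarrow> real^'d) measure) (space (theta N T \<epsilon>)) =
      (\<integral>\<^sup>+x. 1 \<partial>(theta N T \<epsilon> :: (nat \<Rightarrow> real^'d) measure))"
    by simp
  also have "\<dots> \<le> (\<integral>\<^sup>+x. ennreal (exp (cN N T x / \<epsilon>)) \<partial>(theta N T \<epsilon> :: (nat \<Rightarrow> real^'d) measure))"
    using assms by (intro nn_integral_mono) (simp add: cN_nonneg)
  also note nn_integral_exp_cN_theta[OF assms]
  finally show "emeasure (theta N T \<epsilon> :: (nat \<Rightarrow> real^'d) measure) (space (theta N T \<epsilon>)) \<noteq> \<infinity>"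
    by (auto simp: top_unique)
qed

text \<open>The bound holds off the constraint set too, since \<open>chi\<close> is nonnegative; the
  liminf inequality can then use it along arbitrary sequences in \<open>prob_torus\<close>.\<close>

lemma JNeps_ge:
  fixes \<gamma> :: "(nat \<Rightarrow> real^'d) measure"
  assumes "0 < \<epsilon>" "0 < T" "1 \<le> N" "\<epsilon> * T / real N \<le> 1" "\<gamma> \<in> prob_torus N"
  shows "ereal ((\<integral>x. cN N T x \<partial>\<gamma>) - \<epsilon> * ln (heat_const TYPE('d) (\<epsilon> * T / real N) ^ N)) \<le> JNeps N T \<pi> \<epsilon> \<gamma>"
proof -
  let ?K = "heat_const TYPE('d) (\<epsilon> * T / real N) ^ N"
  have pos: "0 < ?K"
    using assms by (intro zero_less_power heat_const_pos) auto
  obtain B where B: "\<And>x :: nat \<Rightarrow> real^'d. x \<in> space (LebT_prod N) \<Longrightarrow> \<bar>cN N T x\<bar> \<le> B"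
    using torus_cont_bounded[OF cN_torus_cont] by metis
  have "ereal ((\<integral>x. cN N T x / \<epsilon> \<partial>\<gamma>) - ln ?K) \<le> rel_entropy \<gamma> (theta N T \<epsilon>)"
  proof (rule rel_entropy_ge[OF finite_measure_theta[OF assms(1-4)], where B = "B / \<epsilon>"])
    show "(\<lambda>x :: nat \<Rightarrow> real^'d. cN N T x / \<epsilon>) \<in> borel_measurable (theta N T \<epsilon>)"
      using measurable_torus_cont[OF cN_torus_cont, where 'd = 'd, of N]
      by (simp cong: measurable_cong_sets)
    show "cN N T x / \<epsilon> \<le> B / \<epsilon>" if "x \<in> space (theta N T \<epsilon>)" for x :: "nat \<Rightarrow> real^'d"
      using B[of x] that assms by (intro divide_right_mono) auto
  qed (use assms pos nn_integral_exp_cN_theta[OF assms(1-4)] in \<open>auto simp: prob_torus_def cN_nonneg\<close>)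
  then have "ereal \<epsilon> * ereal ((\<integral>x. cN N T x / \<epsilon> \<partial>\<gamma>) - ln ?K) \<le> ereal \<epsilon> * rel_entropy \<gamma> (theta N T \<epsilon>)"
    using assms by (intro ereal_mult_left_mono) auto
  also have "\<dots> \<le> JNeps N T \<pi> \<epsilon> \<gamma>"
    unfolding JNeps_def by (simp add: chi_def)
  finally show ?thesis
    using assms by (simp add: right_diff_distrib)
qed

text \<open>\<open>heat_const\<close> is a constant times a power \<epsilon>^(-d/2), so its
  logarithm grows only like ln (1 / \<epsilon>).\<close>

lemma heat_const_error_tendsto:
  assumes "0 < T" "1 \<le> N"
  shows "((\<lambda>\<epsilon>. \<epsilon> * ln (heat_const TYPE('d::finite) (\<epsilon> * T / real N) ^ N)) \<longlongrightarrow> 0) (at_right 0)"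
proof -
  define c where "c = 2 * pi * T / real N"
  define b where "b = (2 * pi) ^ CARD('d) * (exp (real CARD('d) * (2 * pi)\<^sup>2) * lattice_sum_bound TYPE('d))"
  define D where "D = real CARD('d) / 2"
  have pos: "0 < c" "0 < b"
    using assms lattice_sum_bound_pos[where 'd = 'd] by (auto simp: c_def b_def)
  have "((\<lambda>\<epsilon>. \<epsilon> * (real N * (ln b - D * ln (c * \<epsilon>)))) \<longlongrightarrow> 0) (at_right 0)"
    using pos(1) by real_asymp
  moreover have "\<forall>\<^sub>F \<epsilon> in at_right 0. \<epsilon> * (real N * (ln b - D * ln (c * \<epsilon>))) =
      \<epsilon> * ln (heat_const TYPE('d) (\<epsilon> * T / real N) ^ N)"
    using eventually_at_right_less[of "0::real"]
  proof eventually_elim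
    case (elim \<epsilon>)
    have "heat_const TYPE('d) (\<epsilon> * T / real N) = b * (c * \<epsilon>) powr (- D)"
      by (simp add: heat_const_def b_def c_def D_def ac_simps)
    then show ?case
      using pos elim by (simp add: ln_realpow ln_mult ln_powr)
  qed
  ultimately show ?thesis
    by (rule Lim_transform_eventually)
qed

subsection \<open>Weak closedness of the constraint set\<close>

text \<open>These are the full preimages, under the quotient map, of subsets of the product of two
  tori.\<close>

definition lattice_inv :: "((real^'d) \<times> (real^'d)) set \<Rightarrow> bool" where
  "lattice_inv U \<longleftrightarrow> (\<forall>p\<in>U. \<forall>z w. p + (lattice_vec z, lattice_vec w) \<in> U)"

text \<open>A lattice translation maps A into itself, which gives one inequality; the inverse
  translation gives the other. Distance functions to such sets are therefore periodic and can serve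
  as test functions.\<close>

lemma infdist_lattice_inv:
  assumes "lattice_inv A"
  shows "infdist (p + (lattice_vec z, lattice_vec w)) A = infdist p A"
proof (cases "A = {}")
  case False
  have le: "infdist (q + (lattice_vec a, lattice_vec b)) A \<le> infdist q A" for q a b
    unfolding infdist_notempty[OF False, of q]
  proof (rule cINF_greatest[OF False])
    fix r assume "r \<in> A"
    then have "r + (lattice_vec a, lattice_vec b) \<in> A"
      using assms by (auto simp: lattice_inv_def)
    from infdist_le[OF this, of "q + (lattice_vec a, lattice_vec b)"]
    show "infdist (q + (lattice_vec a, lattice_vec b)) A \<le> dist q r"
      by simp
  qed
  have "infdist p A \<le> infdist (p + (lattice_vec z, lattice_vec w)) A"
    using le[of "p + (lattice_vec z, lattice_vec w)" "- z" "- w"]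
    by (cases p) (simp add: lattice_vec_minus)
  with le[of p z w] show ?thesis
    by simp
qed (simp add: infdist_def)

lemma lattice_inv_Compl: "lattice_inv U \<Longrightarrow> lattice_inv (- U)"
  unfolding lattice_inv_def
proof (intro ballI allI)
  fix p z w assume inv: "\<forall>p\<in>U. \<forall>z w. p + (lattice_vec z, lattice_vec w) \<in> U" and p: "p \<in> - U"
  show "p + (lattice_vec z, lattice_vec w) \<in> - U"
  proof
    assume "p + (lattice_vec z, lattice_vec w) \<in> U"
    with inv have "p + (lattice_vec z, lattice_vec w) + (lattice_vec (- z), lattice_vec (- w)) \<in> U"
      by blast
    with p show False
      by (cases p) (simp add: lattice_vec_minus)
  qed
qed

definition torus_cont2 :: "((real^'d) \<times> (real^'d) \<Rightarrow> real) \<Rightarrow> bool" where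
  "torus_cont2 h \<longleftrightarrow> continuous_on UNIV h \<and> (\<forall>p. 0 \<le> h p \<and> h p \<le> 1) \<and>
     (\<forall>p z w. h (p + (lattice_vec z, lattice_vec w)) = h p)"

text \<open>The topology of the product of two tori read on the fundamental domain. It is coarser
  than the subspace topology of the box, since opposite faces are glued.\<close>

definition torus_open2 :: "((real^'d) \<times> (real^'d)) set set" where
  "torus_open2 = {U \<inter> (torus_box \<times> torus_box) | U. open U \<and> lattice_inv U}"

lemma space_LebT2: "space (LebT \<Otimes>\<^sub>M LebT) = torus_box \<times> torus_box"
  by (simp add: space_pair_measure)

lemma measurable_LebT2_borel:
  "(\<lambda>p. p) \<in> measurable (LebT \<Otimes>\<^sub>M LebT) (borel :: ((real^'d) \<times> (real^'d)) measure)"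
proof -
  have "(\<lambda>x. x) \<in> borel_measurable (LebT :: (real^'d) measure)"
    by (intro measurable_LebT_borel) simp
  then have "(\<lambda>p. (fst p, snd p)) \<in> measurable (LebT \<Otimes>\<^sub>M LebT) (borel \<Otimes>\<^sub>M borel :: ((real^'d) \<times> (real^'d)) measure)"
    by (intro measurable_Pair measurable_compose[OF measurable_fst] measurable_compose[OF measurable_snd])
  then show ?thesis
    by (simp add: borel_prod)
qed

text \<open>The coordinate slabs \<open>{a < x\<^sub>j < \<pi>}\<close> extend periodically to open sets, and they generate
  the Borel sets of the half-open box.\<close>
lemma measurable_torus_open2:
  assumes pr: "pr = fst \<or> pr = (snd :: (real^'d) \<times> (real^'d) \<Rightarrow> real^'d)"
  shows "pr \<in> borel_measurable (sigma (torus_box \<times> torus_box) torus_open2)"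
proof -
  let ?S = "sigma (torus_box \<times> torus_box) (torus_open2 :: ((real^'d) \<times> (real^'d)) set set)"
  have sub: "torus_open2 \<subseteq> Pow (torus_box \<times> torus_box :: ((real^'d) \<times> (real^'d)) set)"
    by (auto simp: torus_open2_def)
  have "{p \<in> space ?S. a < pr p $ j} \<in> sets ?S" for a and j :: 'd
  proof (cases "a < - pi")
    case True
    have "a < pr p $ j" if "p \<in> torus_box \<times> torus_box" for p
    proof -
      have "- pi \<le> pr p $ j"
        using that pr by (auto simp: torus_box_def)
      with True show ?thesis by linarith
    qed
    then have "{p \<in> space ?S. a < pr p $ j} = space ?S"
      using sub by auto
    then show ?thesis
      by (metis sets.top)
  next
    case False
    \<comment> \<open>The union of all 2 pi translates of the slab. As a \<ge> -pi in this case,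
      only the translate m = 0 meets the box.\<close>
    define U where "U = (\<Union>m::int. {p. a + 2 * pi * m < pr p $ j} \<inter> {p. pr p $ j < pi + 2 * pi * m})"
    have "open U"
      unfolding U_def using pr
      by (intro open_UN ballI open_Int open_Collect_less) (auto intro!: continuous_intros)
    moreover have "lattice_inv U"
      unfolding lattice_inv_def
    proof (intro ballI allI)
      fix p and z w :: "int^'d" assume "p \<in> U"
      then obtain m :: int where m: "a + 2 * pi * m < pr p $ j" "pr p $ j < pi + 2 * pi * m"
        by (auto simp: U_def)
      define l where "l = (if pr = fst then z $ j else w $ j)"
      have "pr (p + (lattice_vec z, lattice_vec w)) $ j = pr p $ j + 2 * pi * l"
        using pr by (auto simp: l_def lattice_vec_def)
      with m show "p + (lattice_vec z, lattice_vec w) \<in> U"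
        unfolding U_def by (intro UN_I[of "m + l"]) (auto simp: algebra_simps)
    qed
    moreover have "{p \<in> space ?S. a < pr p $ j} = U \<inter> (torus_box \<times> torus_box)"
    proof (intro set_eqI iffI)
      fix p assume p: "p \<in> {p \<in> space ?S. a < pr p $ j}"
      then have "p \<in> torus_box \<times> torus_box"
        using sub by simp
      moreover from this have "pr p $ j < pi"
        using pr by (auto simp: torus_box_def)
      ultimately show "p \<in> U \<inter> (torus_box \<times> torus_box)"
        using p unfolding U_def by (auto intro!: exI[of _ 0])
    next
      fix p assume p: "p \<in> U \<inter> (torus_box \<times> torus_box)"
      then obtain m :: int where m: "a + 2 * pi * m < pr p $ j" "pr p $ j < pi + 2 * pi * m"
        by (auto simp: U_def)
      have s: "- pi \<le> pr p $ j" "pr p $ j < pi"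
        using p pr by (auto simp: torus_box_def)
      have "m = 0"
      proof (rule ccontr)
        assume "m \<noteq> 0"
        then consider "1 \<le> m" | "m \<le> - 1" by linarith
        then show False
        proof cases
          case 1
          then have "2 * pi * 1 \<le> 2 * pi * real_of_int m"
            by (intro mult_left_mono) auto
          with m s False show ?thesis by linarith
        next
          case 2
          then have "2 * pi * real_of_int m \<le> 2 * pi * (- 1)"
            by (intro mult_left_mono) (linarith, simp)
          with m s show ?thesis by linarith
        qed
      qed
      with m p sub show "p \<in> {p \<in> space ?S. a < pr p $ j}"
        by simp
    qed
    ultimately have "{p \<in> space ?S. a < pr p $ j} \<in> torus_open2"
      unfolding torus_open2_def by blast
    then show ?thesis
      using sub by simp
  qed
  then have "(\<lambda>p. pr p $ j) \<in> borel_measurable ?S" for j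
    unfolding borel_measurable_iff_greater by blast
  then show ?thesis
    by (subst borel_measurable_euclidean_space) (auto simp: Basis_vec_def inner_axis)
qed

text \<open>Passing to the coarser torus topology loses no measurable set: both projections are
  measurable for the sigma-algebra it generates, hence so is the identity into the product
  sigma-algebra.\<close>

lemma sets_LebT2: "sets (LebT \<Otimes>\<^sub>M LebT) = sigma_sets (torus_box \<times> torus_box) (torus_open2 :: ((real^'d) \<times> (real^'d)) set set)"
proof
  let ?S = "sigma (torus_box \<times> torus_box) (torus_open2 :: ((real^'d) \<times> (real^'d)) set set)"
  have sub: "torus_open2 \<subseteq> Pow (torus_box \<times> torus_box :: ((real^'d) \<times> (real^'d)) set)"
    by (auto simp: torus_open2_def)
  have "U \<inter> torus_box \<times> torus_box \<in> sets (LebT \<Otimes>\<^sub>M LebT)" if "open U" for U :: "((real^'d) \<times> (real^'d)) set"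
    using measurable_sets[OF measurable_LebT2_borel borel_open[OF that]] by (simp add: space_LebT2)
  then have "(torus_open2 :: ((real^'d) \<times> (real^'d)) set set) \<subseteq> sets (LebT \<Otimes>\<^sub>M LebT)"
    by (auto simp: torus_open2_def)
  then show "sigma_sets (torus_box \<times> torus_box) torus_open2 \<subseteq> sets (LebT \<Otimes>\<^sub>M LebT :: ((real^'d) \<times> (real^'d)) measure)"
    using sets.sigma_sets_subset[of torus_open2 "LebT \<Otimes>\<^sub>M LebT :: ((real^'d) \<times> (real^'d)) measure"]
    by (simp add: space_LebT2)
  have "pr \<in> measurable ?S LebT" if pr: "pr = fst \<or> pr = snd" for pr
  proof -
    have "pr \<in> measurable ?S (restrict_space borel torus_box)"
      using pr sub by (intro measurable_restrict_space2 measurable_torus_open2) auto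
    then show ?thesis
      by (simp cong: measurable_cong_sets add: sets_LebT)
  qed
  then have "(\<lambda>p. (fst p, snd p)) \<in> measurable ?S (LebT \<Otimes>\<^sub>M LebT)"
    by (intro measurable_Pair) auto
  then have id: "(\<lambda>p. p) \<in> measurable ?S (LebT \<Otimes>\<^sub>M LebT)"
    by simp
  show "sets (LebT \<Otimes>\<^sub>M LebT) \<subseteq> sigma_sets (torus_box \<times> torus_box) (torus_open2 :: ((real^'d) \<times> (real^'d)) set set)"
  proof
    fix A :: "((real^'d) \<times> (real^'d)) set" assume A: "A \<in> sets (LebT \<Otimes>\<^sub>M LebT)"
    then have "A \<subseteq> torus_box \<times> torus_box"
      using sets.sets_into_space by (fastforce simp: space_LebT2)
    then show "A \<in> sigma_sets (torus_box \<times> torus_box) torus_open2"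
      using measurable_sets[OF id A] sub by (simp add: Int_absorb2)
  qed
qed

text \<open>Periodic open sets form an intersection-stable generator. The indicator of such a U is
  the limit of min 1 (n dist(p, -U)), which is periodic because the complement of U is, and
  dominated convergence transfers equality of integrals to U.\<close>

lemma measure_eqI_torus_cont2:
  fixes M M' :: "((real^'d) \<times> (real^'d)) measure"
  assumes "finite_measure M" "finite_measure M'"
    and sets: "sets M = sets (LebT \<Otimes>\<^sub>M LebT)" "sets M' = sets (LebT \<Otimes>\<^sub>M LebT)"
    and eq: "\<And>h. torus_cont2 h \<Longrightarrow> (\<integral>p. h p \<partial>M) = (\<integral>p. h p \<partial>M')"
  shows "M = M'"
proof (rule measure_eqI_generator_eq[where E = torus_open2 and \<Omega> = "torus_box \<times> torus_box" and A = "\<lambda>_. torus_box \<times> torus_box"])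
  interpret M: finite_measure M by fact
  interpret M': finite_measure M' by fact
  show "Int_stable (torus_open2 :: ((real^'d) \<times> (real^'d)) set set)"
  proof (rule Int_stableI)
    fix A B :: "((real^'d) \<times> (real^'d)) set" assume "A \<in> torus_open2" "B \<in> torus_open2"
    then obtain U V where "A = U \<inter> (torus_box \<times> torus_box)" "B = V \<inter> (torus_box \<times> torus_box)"
      "open U" "open V" "lattice_inv U" "lattice_inv V"
      by (auto simp: torus_open2_def)
    then show "A \<inter> B \<in> torus_open2"
      unfolding torus_open2_def by (intro CollectI exI[of _ "U \<inter> V"]) (auto simp: lattice_inv_def)
  qed
  have spM: "space M = torus_box \<times> torus_box" "space M' = torus_box \<times> torus_box"
    using sets sets_eq_imp_space_eq by (metis space_LebT2)+
  fix X :: "((real^'d) \<times> (real^'d)) set" assume "X \<in> torus_open2"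
  then obtain U where X: "X = U \<inter> (torus_box \<times> torus_box)" and U: "open U" "lattice_inv U"
    by (auto simp: torus_open2_def)
  show "emeasure M X = emeasure M' X"
  proof (cases "U = UNIV")
    \<comment> \<open>The complement of U is empty here, and \<open>infdist\<close> to the empty set
      is 0 by convention, so the approximation of the other case would vanish identically.\<close>
    case True
    have "torus_cont2 (\<lambda>_ :: (real^'d) \<times> (real^'d). 1)"
      by (simp add: torus_cont2_def)
    from eq[OF this] show ?thesis
      using True X by (simp add: M.emeasure_eq_measure M'.emeasure_eq_measure spM)
  next
    case False
    define h where "h n p = min 1 (real n * infdist p (- U))" for n p
    have h: "torus_cont2 (h n)" for n
      unfolding torus_cont2_def h_def[abs_def]
      by (auto intro!: continuous_intros simp: infdist_nonneg infdist_lattice_inv[OF lattice_inv_Compl[OF U(2)]])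
    have lim: "(\<lambda>n. h n p) \<longlonglongrightarrow> indicat_real U p" for p
    proof (cases "p \<in> U")
      case True
      have "infdist p (- U) > 0"
        using True False U by (intro infdist_pos_not_in_closed) auto
      then obtain n0 where n0: "1 < real n0 * infdist p (- U)"
        using reals_Archimedean3 by blast
      have "h n p = 1" if "n0 \<le> n" for n
      proof -
        have "real n0 * infdist p (- U) \<le> real n * infdist p (- U)"
          using that by (intro mult_right_mono) (auto simp: infdist_nonneg)
        with n0 show ?thesis by (simp add: h_def)
      qed
      then show ?thesis
        using True by (intro tendsto_eventually) (auto simp: eventually_sequentially)
    next
      case False
      then have "h n p = 0" for n
        by (simp add: h_def)
      then show ?thesis
        using False by simp
    qed
    have conv: "(\<lambda>n. \<integral>p. h n p \<partial>Q) \<longlonglongrightarrow> measure Q X"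
      if "finite_measure Q" and Q: "sets Q = sets (LebT \<Otimes>\<^sub>M LebT)" for Q
    proof -
      interpret Q: finite_measure Q by fact
      have id: "(\<lambda>p. p) \<in> measurable Q borel"
        using measurable_LebT2_borel by (simp cong: measurable_cong_sets add: Q)
      have sp: "space Q = torus_box \<times> torus_box"
        using Q sets_eq_imp_space_eq by (metis space_LebT2)
      have "(\<lambda>n. \<integral>p. h n p \<partial>Q) \<longlonglongrightarrow> (\<integral>p. indicat_real U p \<partial>Q)"
      proof (rule integral_dominated_convergence[where w = "\<lambda>_. 1"])
        show "indicat_real U \<in> borel_measurable Q"
          using measurable_compose[OF id, of "indicat_real U" borel] U by simp
        show "h n \<in> borel_measurable Q" for n
          using h[of n] by (intro measurable_compose[OF id, of "h n" borel] borel_measurable_continuous_onI)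
            (auto simp: torus_cont2_def)
        show "AE x in Q. norm (h n x) \<le> 1" for n
          using h[of n] by (auto simp: torus_cont2_def)
      qed (use lim in auto)
      then show ?thesis
        by (simp add: X sp)
    qed
    have "measure M X = measure M' X"
      using LIMSEQ_unique[OF conv[OF assms(1) sets(1)]] conv[OF assms(2) sets(2)] eq[OF h] by simp
    then show ?thesis
      by (simp add: M.emeasure_eq_measure M'.emeasure_eq_measure)
  qed
next
  interpret M: finite_measure M by fact
  show "emeasure M (torus_box \<times> torus_box) \<noteq> \<infinity>"
    by simp
qed (auto simp: torus_open2_def sets sets_LebT2 lattice_inv_def intro!: exI[of _ UNIV])

lemma measurable_pair_LebT_prod:
  assumes "j \<le> N" "k \<le> N"
  shows "(\<lambda>x. (x j, x k)) \<in> measurable (LebT_prod N) (LebT \<Otimes>\<^sub>M LebT)"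
  using assms by measurable

text \<open>A periodic function of two coordinates is an admissible test function, and its integral
  is constant along the sequence. Since such functions separate measures, the limit has the same
  pair marginal.\<close>

lemma weak_limit_pair_marginal:
  fixes \<gamma> :: "(nat \<Rightarrow> real^'d) measure"
  assumes "\<And>n. \<gamma>s n \<in> prob_torus N" "\<gamma> \<in> prob_torus N" "weak_conv_torus \<gamma>s \<gamma>"
    and jk: "j \<le> N" "k \<le> N"
    and marg: "\<And>n. distr (\<gamma>s n) (LebT \<Otimes>\<^sub>M LebT) (\<lambda>x. (x j, x k)) = M"
  shows "distr \<gamma> (LebT \<Otimes>\<^sub>M LebT) (\<lambda>x. (x j, x k)) = M"
proof (rule measure_eqI_torus_cont2)
  have meas: "(\<lambda>x. (x j, x k)) \<in> measurable \<eta> (LebT \<Otimes>\<^sub>M LebT)" if "\<eta> \<in> prob_torus N" for \<eta> :: "(nat \<Rightarrow> real^'d) measure"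
    using measurable_pair_LebT_prod[OF jk] that
    by (subst measurable_cong_sets[where M' = "LebT_prod N"]) (auto simp: prob_torus_def)
  have fin: "finite_measure (distr \<eta> (LebT \<Otimes>\<^sub>M LebT) (\<lambda>x. (x j, x k)))" if "\<eta> \<in> prob_torus N" for \<eta> :: "(nat \<Rightarrow> real^'d) measure"
  proof -
    interpret prob_space \<eta> using that by (simp add: prob_torus_def)
    show ?thesis
      using meas[OF that] by (rule finite_measure_distr)
  qed
  show "finite_measure (distr \<gamma> (LebT \<Otimes>\<^sub>M LebT) (\<lambda>x. (x j, x k)))" "finite_measure M"
    using fin[OF assms(2)] fin[OF assms(1)[of 0]] by (simp_all add: marg)
  show "sets M = sets (LebT \<Otimes>\<^sub>M LebT)"
    by (simp flip: marg[of 0])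
  fix h :: "(real^'d) \<times> (real^'d) \<Rightarrow> real" assume h: "torus_cont2 h"
  have hm: "h \<in> borel_measurable (LebT \<Otimes>\<^sub>M LebT)"
    using h by (intro measurable_compose[OF measurable_LebT2_borel, of h borel] borel_measurable_continuous_onI)
      (auto simp: torus_cont2_def)
  have "torus_cont (\<lambda>x. h (x j, x k))"
    unfolding torus_cont_def
  proof (intro conjI allI)
    have "continuous_on UNIV (\<lambda>x :: nat \<Rightarrow> real^'d. (x j, x k))"
      by (intro continuous_on_Pair continuous_on_product_coordinates)
    then show "continuous_on UNIV (\<lambda>x. h (x j, x k))"
      using h by (intro continuous_on_compose2[where g = h and f = "\<lambda>x. (x j, x k)" and t = UNIV])
        (auto simp: torus_cont2_def)
    fix x :: "nat \<Rightarrow> real^'d" and i :: nat and z :: "int^'d"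
    \<comment> \<open>A shift of coordinate i moves the first slot, the second, both (if j = k = i)
      or neither; all cases are one pair of lattice shifts, possibly zero.\<close>
    have "((x(i := x i + lattice_vec z)) j, (x(i := x i + lattice_vec z)) k) =
        (x j, x k) + (lattice_vec (if i = j then z else 0), lattice_vec (if i = k then z else 0))"
      by (auto simp: lattice_vec_0)
    moreover have "h ((x j, x k) + (lattice_vec (if i = j then z else 0), lattice_vec (if i = k then z else 0))) = h (x j, x k)"
      using h unfolding torus_cont2_def by blast
    ultimately show "h ((x(i := x i + lattice_vec z)) j, (x(i := x i + lattice_vec z)) k) = h (x j, x k)"
      by (simp only:)
  qed
  then have "(\<lambda>n. \<integral>x. h (x j, x k) \<partial>\<gamma>s n) \<longlonglongrightarrow> (\<integral>x. h (x j, x k) \<partial>\<gamma>)"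
    using assms(3) by (simp add: weak_conv_torus_def)
  moreover have "(\<integral>x. h (x j, x k) \<partial>\<gamma>s n) = (\<integral>p. h p \<partial>M)" for n
    unfolding marg[of n, symmetric] by (rule integral_distr[OF meas[OF assms(1)] hm, symmetric])
  ultimately have "(\<integral>x. h (x j, x k) \<partial>\<gamma>) = (\<integral>p. h p \<partial>M)"
    by (simp add: LIMSEQ_const_iff)
  then show "(\<integral>p. h p \<partial>distr \<gamma> (LebT \<Otimes>\<^sub>M LebT) (\<lambda>x. (x j, x k))) = (\<integral>p. h p \<partial>M)"
    by (subst integral_distr[OF meas[OF assms(2)] hm])
qed simp

text \<open>Single marginals are reduced to pair marginals by taking j = k: the pair law is then the
  image of \<open>LebT\<close> on the diagonal, and projecting with \<open>fst\<close> recovers the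
  marginal.\<close>

lemma GammaN_weakly_closed:
  fixes \<gamma> :: "(nat \<Rightarrow> real^'d) measure"
  assumes "\<And>n. \<gamma>s n \<in> GammaN N \<pi>" "\<gamma> \<in> prob_torus N" "weak_conv_torus \<gamma>s \<gamma>"
  shows "\<gamma> \<in> GammaN N \<pi>"
proof -
  have P: "\<gamma>s n \<in> prob_torus N" for n
    using assms(1)[of n] by (simp add: GammaN_def)
  have meas: "(\<lambda>x. (x j, x k)) \<in> measurable \<eta> (LebT \<Otimes>\<^sub>M LebT)" "(\<lambda>x. x j) \<in> measurable \<eta> LebT"
    if "\<eta> \<in> prob_torus N" "j \<le> N" "k \<le> N" for \<eta> :: "(nat \<Rightarrow> real^'d) measure" and j k
    using measurable_pair_LebT_prod[OF that(2,3)] measurable_component_LebT_prod[OF that(2)] that(1)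
    by (subst measurable_cong_sets[where M' = "LebT_prod N"]; force simp: prob_torus_def)+
  have "distr \<gamma> (LebT \<Otimes>\<^sub>M LebT) (\<lambda>x. (x 0, x N)) = \<pi>"
    by (rule weak_limit_pair_marginal[OF P assms(2,3)]) (use assms(1) in \<open>auto simp: GammaN_def\<close>)
  moreover have "distr \<gamma> LebT (\<lambda>x. x k) = LebT" if k: "k \<le> N" for k
  proof -
    have diag: "(\<lambda>a. (a, a)) \<in> measurable LebT (LebT \<Otimes>\<^sub>M (LebT :: (real^'d) measure))"
      by measurable
    have "distr \<gamma> (LebT \<Otimes>\<^sub>M LebT) (\<lambda>x. (x k, x k)) = distr LebT (LebT \<Otimes>\<^sub>M LebT) (\<lambda>a. (a, a))"
    proof (rule weak_limit_pair_marginal[OF P assms(2,3) k k])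
      fix n
      have "distr (\<gamma>s n) LebT (\<lambda>x. x k) = LebT"
        using assms(1)[of n] k by (simp add: GammaN_def)
      then have "distr LebT (LebT \<Otimes>\<^sub>M LebT) (\<lambda>a. (a, a)) =
          distr (distr (\<gamma>s n) LebT (\<lambda>x. x k)) (LebT \<Otimes>\<^sub>M LebT) (\<lambda>a. (a, a))"
        by simp
      also have "\<dots> = distr (\<gamma>s n) (LebT \<Otimes>\<^sub>M LebT) (\<lambda>x. (x k, x k))"
        by (subst distr_distr[OF diag meas(2)[OF P k k]]) (simp add: comp_def)
      finally show "distr (\<gamma>s n) (LebT \<Otimes>\<^sub>M LebT) (\<lambda>x. (x k, x k)) = distr LebT (LebT \<Otimes>\<^sub>M LebT) (\<lambda>a. (a, a))"
        by simp
    qed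
    then have "distr (distr \<gamma> (LebT \<Otimes>\<^sub>M LebT) (\<lambda>x. (x k, x k))) LebT fst =
        distr (distr LebT (LebT \<Otimes>\<^sub>M LebT) (\<lambda>a. (a, a))) LebT fst"
      by simp
    then show ?thesis
      using distr_distr[OF measurable_fst meas(1)[OF assms(2) k k]] distr_distr[OF measurable_fst diag]
      by (simp add: comp_def distr_id2)
  qed
  ultimately show ?thesis
    using assms(2) by (simp add: GammaN_def)
qed

subsection \<open>Averaging over cells\<close>

text \<open>Index of the cube of side 2 pi / m that contains the point, counted from the corner at
  -pi. Floors make the cubes half-open, so they tile the half-open box exactly.\<close>

definition cell :: "nat \<Rightarrow> real^'d \<Rightarrow> int^'d" where
  "cell m x = (\<chi> i. \<lfloor>real m * (x $ i + pi) / (2 * pi)\<rfloor>)"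

text \<open>The density with respect to \<open>LebT\<close> of the uniform law on the cube of x,
  which has mass m^(-d).\<close>

definition cell_kernel :: "nat \<Rightarrow> real^'d \<Rightarrow> real^'d \<Rightarrow> real" where
  "cell_kernel m x y = (if cell m x = cell m y then real m ^ CARD('d) else 0)"

lemma cell_kernel_sym: "cell_kernel m x y = cell_kernel m y x"
  by (auto simp: cell_kernel_def)

lemma cell_kernel_nonneg: "0 \<le> cell_kernel m x y"
  by (simp add: cell_kernel_def)

lemma cell_kernel_le: "cell_kernel m x (y :: real^'d) \<le> real m ^ CARD('d)"
  by (simp add: cell_kernel_def)

lemma cell_eq_iff:
  fixes x :: "real^'d"
  assumes "1 \<le> m"
  shows "cell m x = c \<longleftrightarrow>
    (\<forall>i. - pi + 2 * pi * real_of_int (c $ i) / real m \<le> x $ i \<and>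
         x $ i < - pi + 2 * pi * real_of_int (c $ i) / real m + 2 * pi / real m)"
proof -
  have "\<lfloor>real m * (x $ i + pi) / (2 * pi)\<rfloor> = c $ i \<longleftrightarrow>
    - pi + 2 * pi * real_of_int (c $ i) / real m \<le> x $ i \<and>
         x $ i < - pi + 2 * pi * real_of_int (c $ i) / real m + 2 * pi / real m" for i
    using assms by (simp add: floor_eq_iff field_simps)
  then show ?thesis
    by (simp add: cell_def vec_eq_iff)
qed

lemma cell_bounds:
  fixes x :: "real^'d"
  assumes "1 \<le> m" "x \<in> torus_box"
  shows "0 \<le> cell m x $ i" "cell m x $ i + 1 \<le> int m"
proof -
  have x: "- pi \<le> x $ i" "x $ i < pi"
    using assms by (auto simp: torus_box_def)
  then show "0 \<le> cell m x $ i"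
    by (simp add: cell_def)
  have "real m * (x $ i + pi) < real m * (2 * pi)"
    using x assms by (intro mult_strict_left_mono) auto
  then have "real m * (x $ i + pi) / (2 * pi) < real m"
    by (simp add: field_simps)
  then show "cell m x $ i + 1 \<le> int m"
    by (simp add: cell_def) linarith
qed

text \<open>Cell indices of box points range over 0, ..., m - 1, so no cube sticks out of the box
  and all have the same volume (2 pi / m)^d before normalisation.\<close>

lemma emeasure_cell:
  fixes x :: "real^'d"
  assumes m: "1 \<le> m" and x: "x \<in> torus_box"
  shows "{y. cell m y = cell m x} \<subseteq> torus_box" "{y. cell m y = cell m x} \<in> sets borel"
    and "emeasure LebT {y. cell m y = cell m x} = ennreal (1 / real m ^ CARD('d))"
proof -
  let ?c = "cell m x"
  define a where "a = (\<chi> i. - pi + 2 * pi * real_of_int (?c $ i) / real m)"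
  define b where "b = (\<chi> i. a $ i + 2 * pi / real m)"
  have C: "{y. cell m y = ?c} = {y. \<forall>i. a $ i \<le> y $ i \<and> y $ i < b $ i}"
    using cell_eq_iff[OF m] by (auto simp: a_def b_def)
  have ab: "- pi \<le> a $ i" "b $ i \<le> pi" for i
  proof -
    have "2 * pi * real_of_int (?c $ i) \<ge> 0"
      using cell_bounds(1)[OF m x] by simp
    moreover have "2 * pi * (real_of_int (?c $ i) + 1) \<le> 2 * pi * real m"
      using cell_bounds(2)[OF m x, of i] by (intro mult_left_mono) (linarith, simp)
    ultimately show "- pi \<le> a $ i" "b $ i \<le> pi"
      using m by (auto simp: a_def b_def field_simps)
  qed
  show sub: "{y. cell m y = ?c} \<subseteq> torus_box"
    unfolding C torus_box_def using order_trans[OF ab(1)] less_le_trans[OF _ ab(2)] by blast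
  show meas: "{y. cell m y = ?c} \<in> sets borel"
    unfolding C by (rule half_open_cube_measurable)
  have "emeasure lborel {y. cell m y = ?c} = ennreal ((2 * pi / real m) ^ CARD('d))"
    unfolding C by (rule emeasure_half_open_cube) (auto simp: b_def)
  then have "emeasure LebT {y. cell m y = ?c} =
      ennreal ((2 * pi / real m) ^ CARD('d)) / ennreal ((2 * pi) ^ CARD('d))"
    using emeasure_LebT[OF meas sub] by simp
  also have "\<dots> = ennreal ((2 * pi / real m) ^ CARD('d) / (2 * pi) ^ CARD('d))"
    by (intro divide_ennreal) auto
  also have "(2 * pi / real m) ^ CARD('d) / (2 * pi) ^ CARD('d) = 1 / real m ^ CARD('d)"
    by (simp add: power_divide)
  finally show "emeasure LebT {y. cell m y = cell m x} = ennreal (1 / real m ^ CARD('d))" .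
qed

lemma cell_kernel_dist:
  fixes x y :: "real^'d"
  assumes m: "1 \<le> m" and "cell_kernel m x y \<noteq> 0"
  shows "dist x y \<le> 2 * pi * real CARD('d) / real m"
proof -
  have "cell m y = cell m x"
    using assms by (simp add: cell_kernel_def split: if_splits)
  then have "\<bar>(x - y) $ i\<bar> \<le> 2 * pi / real m" for i
    using cell_eq_iff[OF m, of x "cell m x"] cell_eq_iff[OF m, of y "cell m x"]
    by (auto simp: abs_le_iff dest!: spec[where x = i])
  then have "norm (x - y) \<le> (\<Sum>i\<in>(UNIV :: 'd set). 2 * pi / real m)"
    by (intro order_trans[OF norm_le_l1_cart] sum_mono)
  then show ?thesis
    by (simp add: dist_norm mult.commute)
qed

lemma borel_measurable_cell_kernel:
  "(\<lambda>p. cell_kernel m (fst p) (snd p)) \<in> borel_measurable (LebT \<Otimes>\<^sub>M (LebT :: (real^'d) measure))"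
proof -
  have [measurable]: "(\<lambda>x :: real^'d. x $ i) \<in> borel_measurable borel" for i
    by (intro borel_measurable_continuous_onI continuous_intros)
  have eq: "cell m x = cell m y \<longleftrightarrow> (\<forall>i\<in>UNIV. \<lfloor>real m * (x $ i + pi) / (2 * pi)\<rfloor> = \<lfloor>real m * (y $ i + pi) / (2 * pi)\<rfloor>)"
    for x y :: "real^'d"
    by (simp add: cell_def vec_eq_iff)
  have "(\<lambda>p. cell_kernel m (fst p) (snd p)) \<in> borel_measurable (borel \<Otimes>\<^sub>M (borel :: (real^'d) measure))"
    unfolding cell_kernel_def eq by measurable
  then show ?thesis
    unfolding borel_prod by (rule measurable_compose[OF measurable_LebT2_borel])
qed

lemma measurable_cell_kernel [measurable (raw)]:
  assumes "f \<in> measurable M LebT" "g \<in> measurable M LebT"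
  shows "(\<lambda>x. cell_kernel m (f x) (g x)) \<in> borel_measurable M"
  using measurable_compose[OF measurable_Pair[OF assms] borel_measurable_cell_kernel] by simp

lemma nn_integral_cell_kernel:
  fixes x :: "real^'d"
  assumes "1 \<le> m" "x \<in> torus_box"
  shows "(\<integral>\<^sup>+y. ennreal (cell_kernel m x y) \<partial>LebT) = 1"
proof -
  have "(\<integral>\<^sup>+y. ennreal (cell_kernel m x y) \<partial>LebT) =
      (\<integral>\<^sup>+y. ennreal (real m ^ CARD('d)) * indicator {y. cell m y = cell m x} y \<partial>LebT)"
    by (intro nn_integral_cong) (auto simp: cell_kernel_def split: split_indicator)
  also have "\<dots> = ennreal (real m ^ CARD('d)) * emeasure LebT {y. cell m y = cell m x}"
    using emeasure_cell(1,2)[OF assms] 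
    by (intro nn_integral_cmult_indicator) (auto simp: sets_LebT sets_restrict_space)
  also have "\<dots> = 1"
    using assms by (simp add: emeasure_cell(3)[OF assms] ennreal_mult[symmetric])
  finally show ?thesis .
qed

section \<open>The smoothed plan and its marginals\<close>

definition cell_weight :: "nat \<Rightarrow> nat \<Rightarrow> (nat \<Rightarrow> real^'d) \<Rightarrow> (nat \<Rightarrow> real^'d) \<Rightarrow> real" where
  "cell_weight N m x y = (\<Prod>i\<in>{1..<N}. cell_kernel m (x i) (y i))"

text \<open>Given \<open>x\<close> drawn from \<open>\<gamma>\<close>, the coordinate \<open>y\<^sub>i\<close> with \<open>0 < i < N\<close> is uniform in the cell of
  \<open>x\<^sub>i\<close>; the coordinates \<open>y\<^sub>0\<close> and \<open>y\<^sub>N\<close> are discarded by \<open>cell_merge\<close>.\<close>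
definition cell_joint :: "nat \<Rightarrow> nat \<Rightarrow> (nat \<Rightarrow> real^'d) measure \<Rightarrow> ((nat \<Rightarrow> real^'d) \<times> (nat \<Rightarrow> real^'d)) measure" where
  "cell_joint N m \<gamma> = density (\<gamma> \<Otimes>\<^sub>M LebT_prod N) (\<lambda>p. ennreal (cell_weight N m (fst p) (snd p)))"

definition cell_merge :: "nat \<Rightarrow> (nat \<Rightarrow> 'a) \<times> (nat \<Rightarrow> 'a) \<Rightarrow> nat \<Rightarrow> 'a" where
  "cell_merge N p = (\<lambda>i\<in>{..N}. if i \<in> {1..<N} then snd p i else fst p i)"

definition cell_smooth :: "nat \<Rightarrow> nat \<Rightarrow> (nat \<Rightarrow> real^'d) measure \<Rightarrow> (nat \<Rightarrow> real^'d) measure" where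
  "cell_smooth N m \<gamma> = distr (cell_joint N m \<gamma>) (LebT_prod N) (cell_merge N)"

lemma sets_cell_smooth [simp]: "sets (cell_smooth N m \<gamma>) = sets (LebT_prod N)"
  by (simp add: cell_smooth_def)

text \<open>Padding with factors 1 gives a product over the whole index set, the form in which
  integrals against a product measure factorise.\<close>

lemma ennreal_cell_weight:
  "ennreal (cell_weight N m x y) =
    (\<Prod>j\<le>N. if j \<in> {1..<N} then ennreal (cell_kernel m (x j) (y j)) else 1)"
proof -
  have "ennreal (cell_weight N m x y) = (\<Prod>j\<in>{1..<N}. ennreal (cell_kernel m (x j) (y j)))"
    by (simp add: cell_weight_def prod_ennreal cell_kernel_nonneg)
  also have "\<dots> = (\<Prod>j\<in>{..N} \<inter> {1..<N}. ennreal (cell_kernel m (x j) (y j)))"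
    by (rule prod.cong) auto
  also have "\<dots> = (\<Prod>j\<le>N. if j \<in> {1..<N} then ennreal (cell_kernel m (x j) (y j)) else 1)"
    by (rule prod.inter_restrict) simp
  finally show ?thesis .
qed

text \<open>Under the product measure the integral splits into one factor per coordinate; every
  factor except the i-th integrates to 1, by normalisation of the kernel or of
  \<open>LebT\<close>.\<close>

lemma nn_integral_cell_weight:
  fixes x :: "nat \<Rightarrow> real^'d"
  assumes m: "1 \<le> m" and x: "x \<in> space (LebT_prod N)" and i: "i \<in> {1..<N}"
    and G: "G \<in> borel_measurable LebT"
  shows "(\<integral>\<^sup>+y. ennreal (cell_weight N m x y) * G (y i) \<partial>LebT_prod N) =
    (\<integral>\<^sup>+b. ennreal (cell_kernel m (x i) b) * G b \<partial>LebT)"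
proof -
  have xb: "x j \<in> torus_box" if "j \<le> N" for j
    using x that by (auto simp: space_LebT_prod)
  define F where "F j b = (if j \<in> {1..<N} then ennreal (cell_kernel m (x j) b) else 1) *
      (if j = i then G b else 1)" for j b
  have F_meas: "F j \<in> borel_measurable LebT" if "j \<le> N" for j
  proof -
    have [measurable]: "(\<lambda>b. cell_kernel m (x j) b) \<in> borel_measurable LebT"
      using xb[OF that] by (intro measurable_cell_kernel) auto
    note G[measurable]
    show ?thesis
      unfolding F_def[abs_def] by measurable
  qed
  have "(\<integral>\<^sup>+y. ennreal (cell_weight N m x y) * G (y i) \<partial>LebT_prod N) =
      (\<integral>\<^sup>+y. (\<Prod>j\<le>N. F j (y j)) \<partial>LebT_prod N)"
    using i unfolding F_def prod.distrib ennreal_cell_weight[symmetric]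
    by (intro nn_integral_cong) (simp add: prod.delta)
  also have "\<dots> = (\<Prod>j\<le>N. \<integral>\<^sup>+b. F j b \<partial>LebT)"
    unfolding LebT_prod_def by (rule LebT_PiM.product_nn_integral_prod) (auto intro: F_meas)
  also have "\<dots> = (\<Prod>j\<le>N. if j = i then \<integral>\<^sup>+b. F i b \<partial>LebT else 1)"
  proof (intro prod.cong refl)
    fix j assume "j \<in> {..N}"
    show "(\<integral>\<^sup>+b. F j b \<partial>LebT) = (if j = i then \<integral>\<^sup>+b. F i b \<partial>LebT else 1)"
    proof (cases "j = i")
      case False
      then show ?thesis
        using m xb[of j] LebT.emeasure_space_1 \<open>j \<in> {..N}\<close>
        by (cases "j \<in> {1..<N}") (auto simp: F_def nn_integral_cell_kernel)
    qed simp
  qed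
  also have "\<dots> = (\<integral>\<^sup>+b. ennreal (cell_kernel m (x i) b) * G b \<partial>LebT)"
    using i by (simp add: prod.delta F_def[abs_def])
  finally show ?thesis .
qed

lemma nn_integral_cell_weight_1:
  fixes x :: "nat \<Rightarrow> real^'d"
  assumes m: "1 \<le> m" and x: "x \<in> space (LebT_prod N)"
  shows "(\<integral>\<^sup>+y. ennreal (cell_weight N m x y) \<partial>LebT_prod N) = 1"
proof (cases "{1..<N} = {}")
  \<comment> \<open>For N \<le> 1 there is no interior coordinate and the weight is an empty
    product.\<close>
  case True
  then show ?thesis
    by (simp add: cell_weight_def prob_space.emeasure_space_1[OF prob_space_LebT_prod])
next
  case False
  then obtain i where i: "i \<in> {1..<N}"
    by blast
  have "x i \<in> torus_box"
    using x i by (auto simp: space_LebT_prod)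
  then show ?thesis
    using nn_integral_cell_weight[OF m x i, of "\<lambda>_. 1"] m by (simp add: nn_integral_cell_kernel)
qed

lemma measurable_cell_weight:
  assumes "sets \<gamma> = sets (LebT_prod N)"
  shows "(\<lambda>p. cell_weight N m (fst p) (snd p)) \<in> borel_measurable (\<gamma> \<Otimes>\<^sub>M (LebT_prod N :: (nat \<Rightarrow> real^'d) measure))"
proof -
  have "(\<lambda>p. cell_weight N m (fst p) (snd p)) \<in> borel_measurable (LebT_prod N \<Otimes>\<^sub>M (LebT_prod N :: (nat \<Rightarrow> real^'d) measure))"
    unfolding cell_weight_def
    by (intro borel_measurable_prod measurable_cell_kernel
        measurable_compose[OF measurable_fst measurable_component_LebT_prod]
        measurable_compose[OF measurable_snd measurable_component_LebT_prod]) auto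
  moreover have "sets (\<gamma> \<Otimes>\<^sub>M LebT_prod N) = sets (LebT_prod N \<Otimes>\<^sub>M (LebT_prod N :: (nat \<Rightarrow> real^'d) measure))"
    using assms by (rule sets_pair_measure_cong) simp
  ultimately show ?thesis
    by (simp cong: measurable_cong_sets)
qed

lemma measurable_cell_merge:
  assumes "sets \<gamma> = sets (LebT_prod N)"
  shows "cell_merge N \<in> measurable (\<gamma> \<Otimes>\<^sub>M LebT_prod N) (LebT_prod N :: (nat \<Rightarrow> real^'d) measure)"
proof -
  have "cell_merge N \<in> measurable (LebT_prod N \<Otimes>\<^sub>M LebT_prod N) (PiM {..N} (\<lambda>_. LebT :: (real^'d) measure))"
    unfolding cell_merge_def[abs_def]
  proof (rule measurable_restrict)
    fix i assume "i \<in> {..N}"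
    then have "i \<le> N" by simp
    then show "(\<lambda>p. if i \<in> {1..<N} then snd p i else fst p i) \<in>
        measurable (LebT_prod N \<Otimes>\<^sub>M LebT_prod N) (LebT :: (real^'d) measure)"
      using measurable_compose[OF measurable_fst[of "LebT_prod N" "LebT_prod N"] measurable_component_LebT_prod]
        measurable_compose[OF measurable_snd[of "LebT_prod N" "LebT_prod N"] measurable_component_LebT_prod]
      by (cases "i \<in> {1..<N}") (simp_all del: atLeastLessThan_iff)
  qed
  moreover have "sets (\<gamma> \<Otimes>\<^sub>M LebT_prod N) = sets (LebT_prod N \<Otimes>\<^sub>M (LebT_prod N :: (nat \<Rightarrow> real^'d) measure))"
    using assms by (rule sets_pair_measure_cong) simp
  ultimately show ?thesis
    by (simp cong: measurable_cong_sets flip: LebT_prod_def)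
qed

lemma sets_cell_joint: "sets (cell_joint N m \<gamma>) = sets (\<gamma> \<Otimes>\<^sub>M LebT_prod N)"
  by (simp add: cell_joint_def)

lemma nn_integral_cell_joint:
  fixes \<gamma> :: "(nat \<Rightarrow> real^'d) measure"
  assumes sets: "sets \<gamma> = sets (LebT_prod N)" and F: "F \<in> borel_measurable (\<gamma> \<Otimes>\<^sub>M LebT_prod N)"
  shows "(\<integral>\<^sup>+p. F p \<partial>cell_joint N m \<gamma>) =
    (\<integral>\<^sup>+x. \<integral>\<^sup>+y. ennreal (cell_weight N m x y) * F (x, y) \<partial>LebT_prod N \<partial>\<gamma>)"
proof -
  interpret L: prob_space "LebT_prod N :: (nat \<Rightarrow> real^'d) measure"
    by (rule prob_space_LebT_prod)
  note F[measurable] measurable_cell_weight[OF sets, measurable]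
  have "(\<integral>\<^sup>+p. F p \<partial>cell_joint N m \<gamma>) =
      (\<integral>\<^sup>+p. ennreal (cell_weight N m (fst p) (snd p)) * F p \<partial>(\<gamma> \<Otimes>\<^sub>M LebT_prod N))"
    unfolding cell_joint_def by (rule nn_integral_density) measurable
  also have "\<dots> = (\<integral>\<^sup>+x. \<integral>\<^sup>+y. ennreal (cell_weight N m x y) * F (x, y) \<partial>LebT_prod N \<partial>\<gamma>)"
    using L.nn_integral_fst[of "\<lambda>p. ennreal (cell_weight N m (fst p) (snd p)) * F p" \<gamma>] by simp
  finally show ?thesis .
qed

text \<open>The weight integrates to 1 in y for each fixed x. Besides keeping the endpoint law, this
  shows that \<open>cell_joint\<close> has mass 1 when \<open>\<gamma>\<close> does.\<close>

lemma distr_fst_cell_joint: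
  fixes \<gamma> :: "(nat \<Rightarrow> real^'d) measure"
  assumes sets: "sets \<gamma> = sets (LebT_prod N)" and m: "1 \<le> m"
  shows "distr (cell_joint N m \<gamma>) \<gamma> fst = \<gamma>"
proof (rule measure_eqI)
  fix A assume "A \<in> sets (distr (cell_joint N m \<gamma>) \<gamma> fst)"
  then have A: "A \<in> sets \<gamma>" by simp
  have fst: "fst \<in> measurable (cell_joint N m \<gamma>) \<gamma>"
    by (simp cong: measurable_cong_sets add: sets_cell_joint)
  have sp: "space \<gamma> = space (LebT_prod N)"
    by (rule sets_eq_imp_space_eq[OF sets])
  have "emeasure (distr (cell_joint N m \<gamma>) \<gamma> fst) A = (\<integral>\<^sup>+x. indicator A x \<partial>distr (cell_joint N m \<gamma>) \<gamma> fst)"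
    using A by simp
  also have "\<dots> = (\<integral>\<^sup>+p. indicator A (fst p) \<partial>cell_joint N m \<gamma>)"
    using A by (intro nn_integral_distr fst) simp
  also have "\<dots> = (\<integral>\<^sup>+x. \<integral>\<^sup>+y. ennreal (cell_weight N m x y) * indicator A x \<partial>LebT_prod N \<partial>\<gamma>)"
    using A by (subst nn_integral_cell_joint[OF sets]) (auto intro: measurable_compose[OF measurable_fst])
  also have "\<dots> = (\<integral>\<^sup>+x. indicator A x \<partial>\<gamma>)"
  proof (intro nn_integral_cong)
    fix x assume "x \<in> space \<gamma>"
    then show "(\<integral>\<^sup>+y. ennreal (cell_weight N m x y) * indicator A x \<partial>LebT_prod N) = indicator A x"
      using nn_integral_cell_weight_1[OF m, of x N] by (auto simp: sp split: split_indicator)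
  qed
  finally show "emeasure (distr (cell_joint N m \<gamma>) \<gamma> fst) A = emeasure \<gamma> A"
    using A by simp
qed simp

text \<open>As x_i is uniform, Tonelli lets the kernel be integrated in its first variable; by
  symmetry that integral is again 1, so y_i is uniform.\<close>

lemma distr_snd_cell_joint:
  fixes \<gamma> :: "(nat \<Rightarrow> real^'d) measure"
  assumes sets: "sets \<gamma> = sets (LebT_prod N)" and m: "1 \<le> m" and i: "i \<in> {1..<N}"
    and marg: "distr \<gamma> LebT (\<lambda>x. x i) = LebT"
  shows "distr (cell_joint N m \<gamma>) LebT (\<lambda>p. snd p i) = LebT"
proof (rule measure_eqI)
  fix A :: "(real^'d) set" assume "A \<in> sets (distr (cell_joint N m \<gamma>) LebT (\<lambda>p. snd p i))"
  then have A[measurable]: "A \<in> sets LebT" by simp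
  have iN: "i \<le> N" using i by simp
  have snd': "(\<lambda>p. snd p i) \<in> measurable (\<gamma> \<Otimes>\<^sub>M LebT_prod N) LebT"
    by (rule measurable_compose[OF measurable_snd measurable_component_LebT_prod[OF iN]])
  then have snd: "(\<lambda>p. snd p i) \<in> measurable (cell_joint N m \<gamma>) LebT"
    by (simp cong: measurable_cong_sets add: sets_cell_joint)
  have xi: "(\<lambda>x. x i) \<in> measurable \<gamma> LebT"
    using measurable_component_LebT_prod[OF iN] by (simp cong: measurable_cong_sets add: sets)
  have sp: "space \<gamma> = space (LebT_prod N)"
    by (rule sets_eq_imp_space_eq[OF sets])
  have "emeasure (distr (cell_joint N m \<gamma>) LebT (\<lambda>p. snd p i)) A =
      (\<integral>\<^sup>+x. indicator A x \<partial>distr (cell_joint N m \<gamma>) LebT (\<lambda>p. snd p i))"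
    by simp
  also have "\<dots> = (\<integral>\<^sup>+p. indicator A (snd p i) \<partial>cell_joint N m \<gamma>)"
    by (intro nn_integral_distr snd) simp
  also have "\<dots> = (\<integral>\<^sup>+x. \<integral>\<^sup>+y. ennreal (cell_weight N m x y) * indicator A (y i) \<partial>LebT_prod N \<partial>\<gamma>)"
    by (subst nn_integral_cell_joint[OF sets]) (auto intro: measurable_compose[OF snd'])
  also have "\<dots> = (\<integral>\<^sup>+x. \<integral>\<^sup>+b. ennreal (cell_kernel m (x i) b) * indicator A b \<partial>LebT \<partial>\<gamma>)"
    using m i by (intro nn_integral_cong nn_integral_cell_weight) (auto simp: sp)
  also have "\<dots> = (\<integral>\<^sup>+a. \<integral>\<^sup>+b. ennreal (cell_kernel m a b) * indicator A b \<partial>LebT \<partial>distr \<gamma> LebT (\<lambda>x. x i))"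
    by (intro nn_integral_distr[symmetric] xi) measurable
  also have "\<dots> = (\<integral>\<^sup>+a. \<integral>\<^sup>+b. ennreal (cell_kernel m a b) * indicator A b \<partial>LebT \<partial>LebT)"
    unfolding marg ..
  also have "\<dots> = (\<integral>\<^sup>+b. \<integral>\<^sup>+a. ennreal (cell_kernel m a b) * indicator A b \<partial>LebT \<partial>LebT)"
  proof -
    interpret pair_sigma_finite LebT "LebT :: (real^'d) measure" by unfold_locales
    show ?thesis
      by (rule Fubini'[symmetric]) measurable
  qed
  also have "\<dots> = (\<integral>\<^sup>+b. indicator A b \<partial>LebT)"
    using m by (intro nn_integral_cong)
      (auto simp: cell_kernel_sym[of m _ b for b] nn_integral_cell_kernel split: split_indicator)
  finally show "emeasure (distr (cell_joint N m \<gamma>) LebT (\<lambda>p. snd p i)) A = emeasure LebT A"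
    by simp
qed simp

text \<open>Endpoint coordinates of the merged configuration are read off the first component of
  \<open>cell_joint\<close>, interior ones off the second; the two marginal lemmas above cover these
  cases.\<close>

lemma cell_smooth_GammaN:
  fixes \<gamma> :: "(nat \<Rightarrow> real^'d) measure"
  assumes \<gamma>: "\<gamma> \<in> GammaN N \<pi>" and m: "1 \<le> m"
  shows "cell_smooth N m \<gamma> \<in> GammaN N \<pi>"
proof -
  have sets: "sets \<gamma> = sets (LebT_prod N)" and "prob_space \<gamma>"
    and marg: "\<And>k. k \<le> N \<Longrightarrow> distr \<gamma> LebT (\<lambda>x. x k) = LebT"
    and \<pi>: "distr \<gamma> (LebT \<Otimes>\<^sub>M LebT) (\<lambda>x. (x 0, x N)) = \<pi>"
    using \<gamma> by (auto simp: GammaN_def prob_torus_def)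
  interpret \<gamma>: prob_space \<gamma> by fact
  note fst_distr = distr_fst_cell_joint[OF sets m]
  have fst: "fst \<in> measurable (cell_joint N m \<gamma>) \<gamma>"
    by (simp cong: measurable_cong_sets add: sets_cell_joint)
  have merge: "cell_merge N \<in> measurable (cell_joint N m \<gamma>) (LebT_prod N)"
    using measurable_cell_merge[OF sets] by (simp cong: measurable_cong_sets add: sets_cell_joint)
  have "emeasure (cell_joint N m \<gamma>) (space (cell_joint N m \<gamma>)) = emeasure (distr (cell_joint N m \<gamma>) \<gamma> fst) (space \<gamma>)"
    using measurable_space[OF fst] by (subst emeasure_distr[OF fst]) (auto intro!: arg_cong2[where f = emeasure])
  then have "prob_space (cell_joint N m \<gamma>)"
    unfolding fst_distr \<gamma>.emeasure_space_1 by (rule prob_spaceI)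
  then have "prob_space (cell_smooth N m \<gamma>)"
    unfolding cell_smooth_def by (rule prob_space.prob_space_distr[OF _ merge])
  moreover have "distr (cell_smooth N m \<gamma>) LebT (\<lambda>x. x k) = LebT" if k: "k \<le> N" for k
  proof -
    have *: "distr (cell_smooth N m \<gamma>) LebT (\<lambda>x. x k) = distr (cell_joint N m \<gamma>) LebT (\<lambda>p. cell_merge N p k)"
      unfolding cell_smooth_def
      by (subst distr_distr[OF measurable_component_LebT_prod[OF k] merge]) (simp add: comp_def)
    show ?thesis
    proof (cases "k \<in> {1..<N}")
      case True
      then show ?thesis
        using distr_snd_cell_joint[OF sets m True marg[OF k]] k by (simp add: * cell_merge_def)
    next
      case False
      have xk: "(\<lambda>x. x k) \<in> measurable \<gamma> LebT"
        using measurable_component_LebT_prod[OF k] by (simp cong: measurable_cong_sets add: sets)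
      have "distr (cell_joint N m \<gamma>) LebT (\<lambda>p. cell_merge N p k) = distr (cell_joint N m \<gamma>) LebT (\<lambda>p. fst p k)"
        using False k by (auto simp: cell_merge_def)
      also have "\<dots> = distr (distr (cell_joint N m \<gamma>) \<gamma> fst) LebT (\<lambda>x. x k)"
        by (subst distr_distr[OF xk fst]) (simp add: comp_def)
      finally show ?thesis
        using * marg[OF k] by (simp add: fst_distr)
    qed
  qed
  moreover have "distr (cell_smooth N m \<gamma>) (LebT \<Otimes>\<^sub>M LebT) (\<lambda>x. (x 0, x N)) = \<pi>"
  proof -
    have p: "(\<lambda>x. (x 0, x N)) \<in> measurable (LebT_prod N) (LebT \<Otimes>\<^sub>M (LebT :: (real^'d) measure))"
      by (rule measurable_pair_LebT_prod) auto
    then have p\<gamma>: "(\<lambda>x. (x 0, x N)) \<in> measurable \<gamma> (LebT \<Otimes>\<^sub>M (LebT :: (real^'d) measure))"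
      by (simp cong: measurable_cong_sets add: sets)
    have "distr (cell_smooth N m \<gamma>) (LebT \<Otimes>\<^sub>M LebT) (\<lambda>x. (x 0, x N)) =
        distr (cell_joint N m \<gamma>) (LebT \<Otimes>\<^sub>M LebT) (\<lambda>p. (fst p 0, fst p N))"
      unfolding cell_smooth_def
      by (subst distr_distr[OF p merge]) (simp add: comp_def cell_merge_def)
    also have "\<dots> = distr (distr (cell_joint N m \<gamma>) \<gamma> fst) (LebT \<Otimes>\<^sub>M LebT) (\<lambda>x. (x 0, x N))"
      by (subst distr_distr[OF p\<gamma> fst]) (simp add: comp_def)
    finally show ?thesis
      by (simp add: fst_distr \<pi>)
  qed
  ultimately show ?thesis
    by (simp add: GammaN_def prob_torus_def)
qed

text \<open>\<open>cell_joint\<close> couples the smoothed plan with \<open>\<gamma>\<close> itself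
  so that coordinates differ by at most 2 pi d / m; uniform continuity of the test function then
  bounds the difference of the integrals.\<close>

lemma cell_smooth_weak_conv:
  fixes \<gamma> :: "(nat \<Rightarrow> real^'d) measure"
  assumes \<gamma>: "\<gamma> \<in> prob_torus N" and m: "\<And>n. 1 \<le> m n" "filterlim m at_top sequentially"
  shows "weak_conv_torus (\<lambda>n. cell_smooth N (m n) \<gamma>) \<gamma>"
  unfolding weak_conv_torus_def
proof (intro allI impI)
  fix f :: "(nat \<Rightarrow> real^'d) \<Rightarrow> real" assume f: "torus_cont f"
  have sets: "sets \<gamma> = sets (LebT_prod N)" and "prob_space \<gamma>"
    using \<gamma> by (auto simp: prob_torus_def)
  interpret \<gamma>: prob_space \<gamma> by fact
  have sp: "space \<gamma> = space (LebT_prod N)"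
    by (rule sets_eq_imp_space_eq[OF sets])
  have fm: "f \<in> borel_measurable (LebT_prod N)"
    by (rule measurable_torus_cont[OF f])
  then have fm\<gamma>: "f \<in> borel_measurable \<gamma>"
    by (simp cong: measurable_cong_sets add: sets)
  obtain B where B: "\<And>x. x \<in> space (LebT_prod N) \<Longrightarrow> \<bar>f x\<bar> \<le> B"
    using torus_cont_bounded[OF f] by metis
  show "(\<lambda>n. \<integral>x. f x \<partial>cell_smooth N (m n) \<gamma>) \<longlonglongrightarrow> (\<integral>x. f x \<partial>\<gamma>)"
  proof (rule LIMSEQ_I)
    fix r :: real assume "0 < r"
    obtain \<delta> where "0 < \<delta>" and \<delta>: "\<And>x y. x \<in> space (LebT_prod N) \<Longrightarrow> y \<in> space (LebT_prod N) \<Longrightarrow>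
      (\<And>i. dist (x i) (y i) \<le> \<delta>) \<Longrightarrow> \<bar>f x - f y\<bar> \<le> r / 2"
      using torus_cont_uniformly[OF f, of "r / 2" N] \<open>0 < r\<close> by (metis half_gt_zero)
    define C where "C = 2 * pi * real CARD('d)"
    have "\<forall>\<^sub>F n in sequentially. nat \<lceil>C / \<delta>\<rceil> \<le> m n"
      using m(2) unfolding filterlim_at_top by blast
    then obtain n0 where n0: "\<And>n. n0 \<le> n \<Longrightarrow> nat \<lceil>C / \<delta>\<rceil> \<le> m n"
      by (auto simp: eventually_sequentially)
    have "norm ((\<integral>x. f x \<partial>cell_smooth N (m n) \<gamma>) - (\<integral>x. f x \<partial>\<gamma>)) < r" if "n0 \<le> n" for n
    proof -
      let ?J = "cell_joint N (m n) \<gamma>"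
      have "C / \<delta> \<le> real (m n)"
        using n0[OF that] by linarith
      then have Cm: "C / real (m n) \<le> \<delta>"
        using m(1)[of n] \<open>0 < \<delta>\<close> by (simp add: field_simps)
      have fst: "fst \<in> measurable ?J \<gamma>"
        by (simp cong: measurable_cong_sets add: sets_cell_joint)
      have merge: "cell_merge N \<in> measurable ?J (LebT_prod N)"
        using measurable_cell_merge[OF sets] by (simp cong: measurable_cong_sets add: sets_cell_joint)
      have "emeasure ?J (space ?J) = emeasure (distr ?J \<gamma> fst) (space \<gamma>)"
        using measurable_space[OF fst] by (subst emeasure_distr[OF fst]) (auto intro!: arg_cong2[where f = emeasure])
      then have "prob_space ?J"
        unfolding distr_fst_cell_joint[OF sets m(1)] \<gamma>.emeasure_space_1 by (rule prob_spaceI)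
      then interpret J: prob_space ?J .
      have i1: "integrable ?J (\<lambda>p. f (cell_merge N p))"
        using measurable_space[OF merge] B measurable_compose[OF merge fm]
        by (intro J.integrable_const_bound[where B = B]) auto
      have i2: "integrable ?J (\<lambda>p. f (fst p))"
        using measurable_space[OF fst] B measurable_compose[OF fst fm\<gamma>]
        by (intro J.integrable_const_bound[where B = B]) (auto simp: sp)
      have 1: "(\<integral>x. f x \<partial>cell_smooth N (m n) \<gamma>) = (\<integral>p. f (cell_merge N p) \<partial>?J)"
        unfolding cell_smooth_def by (rule integral_distr[OF merge fm])
      have "(\<integral>x. f x \<partial>\<gamma>) = (\<integral>x. f x \<partial>distr ?J \<gamma> fst)"
        by (simp add: distr_fst_cell_joint[OF sets m(1)])
      also have "\<dots> = (\<integral>p. f (fst p) \<partial>?J)"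
        by (rule integral_distr[OF fst fm\<gamma>])
      finally have 2: "(\<integral>x. f x \<partial>\<gamma>) = (\<integral>p. f (fst p) \<partial>?J)" .
      \<comment> \<open>Only points of positive weight count for a density measure, and there every
        interior kernel is nonzero, so x_i and y_i share a cube.\<close>
      have "AE p in \<gamma> \<Otimes>\<^sub>M LebT_prod N. 0 < ennreal (cell_weight N (m n) (fst p) (snd p)) \<longrightarrow>
          \<bar>f (cell_merge N p) - f (fst p)\<bar> \<le> r / 2"
      proof (intro AE_I2 impI)
        fix p assume p: "p \<in> space (\<gamma> \<Otimes>\<^sub>M LebT_prod N)"
          and pos: "0 < ennreal (cell_weight N (m n) (fst p) (snd p))"
        have x: "fst p \<in> space (LebT_prod N)"
          using p by (auto simp: space_pair_measure sp)
        have G: "cell_merge N p \<in> space (LebT_prod N)"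
          using measurable_space[OF merge, of p] p by (simp add: cell_joint_def)
        show "\<bar>f (cell_merge N p) - f (fst p)\<bar> \<le> r / 2"
        proof (rule \<delta>[OF G x])
          fix i
          show "dist (cell_merge N p i) (fst p i) \<le> \<delta>"
          proof (cases "i \<in> {1..<N}")
            case True
            have "cell_weight N (m n) (fst p) (snd p) \<noteq> 0"
              using pos by auto
            with True have "cell_kernel (m n) (fst p i) (snd p i) \<noteq> 0"
              unfolding cell_weight_def by (subst (asm) prod_zero_iff) auto
            from cell_kernel_dist[OF m(1) this] show ?thesis
              using True Cm by (simp add: cell_merge_def dist_commute C_def)
          next
            case False
            then have "cell_merge N p i = fst p i"
              using x by (auto simp: cell_merge_def space_LebT_prod PiE_def extensional_def)
            then show ?thesis
              using \<open>0 < \<delta>\<close> by simp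
          qed
        qed
      qed
      then have AE: "AE p in ?J. \<bar>f (cell_merge N p) - f (fst p)\<bar> \<le> r / 2"
        unfolding cell_joint_def using measurable_cell_weight[OF sets]
        by (subst AE_density) auto
      have "\<bar>(\<integral>p. f (cell_merge N p) - f (fst p) \<partial>?J)\<bar> \<le> (\<integral>p. \<bar>f (cell_merge N p) - f (fst p)\<bar> \<partial>?J)"
        by (rule integral_abs_bound)
      also have "\<dots> \<le> (\<integral>p. r / 2 \<partial>?J)"
        using AE i1 i2 by (intro integral_mono_AE) auto
      also have "\<dots> < r"
        using \<open>0 < r\<close> by (simp add: J.prob_space)
      finally show ?thesis
        unfolding 1 2 using i1 i2 by simp
    qed
    then show "\<exists>n0. \<forall>n\<ge>n0. norm ((\<integral>x. f x \<partial>cell_smooth N (m n) \<gamma>) - (\<integral>x. f x \<partial>\<gamma>)) < r"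
      by blast
  qed
qed

section \<open>Density and entropy of the smoothed plan\<close>

lemma nn_integral_LebT_prod_resample:
  fixes Q :: "(nat \<Rightarrow> real^'d) \<Rightarrow> ennreal"
  assumes Q: "Q \<in> borel_measurable (LebT_prod N)" and k: "k \<le> N"
  shows "(\<integral>\<^sup>+a. \<integral>\<^sup>+y. Q (y(k := a)) \<partial>LebT_prod N \<partial>LebT) = (\<integral>\<^sup>+y. Q y \<partial>LebT_prod N)"
proof -
  interpret L: prob_space "LebT_prod N :: (nat \<Rightarrow> real^'d) measure"
    by (rule prob_space_LebT_prod)
  \<comment> \<open>\<open>distr_pair_PiM_eq_PiM\<close> adjoins an independent coordinate k to a
    product. With k already present, it says that overwriting coordinate k by a fresh uniform sample
    leaves the law unchanged.\<close>
  have ins: "insert k {..N} = {..N}"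
    using k by auto
  have upd: "(\<lambda>(a, y). y(k := a)) \<in> measurable (LebT \<Otimes>\<^sub>M LebT_prod N) (LebT_prod N :: (nat \<Rightarrow> real^'d) measure)"
    unfolding LebT_prod_def split_beta'
    using k by (intro measurable_fun_upd[where J = "{..N}"]) auto
  have "(LebT_prod N :: (nat \<Rightarrow> real^'d) measure) = distr (LebT \<Otimes>\<^sub>M LebT_prod N) (LebT_prod N) (\<lambda>(a, y). y(k := a))"
    using distr_pair_PiM_eq_PiM[of "{..N}" "\<lambda>_. LebT :: (real^'d) measure" k] prob_space_LebT
    unfolding LebT_prod_def ins by metis
  then have "(\<integral>\<^sup>+y. Q y \<partial>LebT_prod N) =
      (\<integral>\<^sup>+y. Q y \<partial>distr (LebT \<Otimes>\<^sub>M LebT_prod N) (LebT_prod N) (\<lambda>(a, y). y(k := a)))"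
    by metis
  also have "\<dots> = (\<integral>\<^sup>+q. Q ((\<lambda>(a, y). y(k := a)) q) \<partial>(LebT \<Otimes>\<^sub>M LebT_prod N))"
    by (rule nn_integral_distr[OF upd]) (simp add: Q)
  also have "\<dots> = (\<integral>\<^sup>+a. \<integral>\<^sup>+y. Q (y(k := a)) \<partial>LebT_prod N \<partial>LebT)"
    using L.nn_integral_fst[OF measurable_compose[OF upd Q]] by simp
  finally show ?thesis ..
qed

lemma measurable_fun_upd2_LebT_prod:
  "(\<lambda>q. (snd q)(0 := fst (fst q), N := snd (fst q))) \<in>
    measurable ((LebT \<Otimes>\<^sub>M LebT) \<Otimes>\<^sub>M LebT_prod N) (LebT_prod N :: (nat \<Rightarrow> real^'d) measure)"
  unfolding LebT_prod_def
  by (intro measurable_fun_upd[where J = "{..N}"]) auto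

text \<open>Resampling twice disintegrates the product measure along its two endpoints. The updates
  at 0 and N commute because 1 \<le> N makes the indices distinct.\<close>

lemma nn_integral_LebT_prod_resample2:
  fixes Q :: "(nat \<Rightarrow> real^'d) \<Rightarrow> ennreal"
  assumes Q: "Q \<in> borel_measurable (LebT_prod N)" and N: "1 \<le> N"
  shows "(\<integral>\<^sup>+q. \<integral>\<^sup>+y. Q (y(0 := fst q, N := snd q)) \<partial>LebT_prod N \<partial>(LebT \<Otimes>\<^sub>M LebT)) =
    (\<integral>\<^sup>+y. Q y \<partial>LebT_prod N)"
proof -
  interpret L: prob_space "LebT_prod N :: (nat \<Rightarrow> real^'d) measure"
    by (rule prob_space_LebT_prod)
  have upd: "(\<lambda>y. y(0 := a)) \<in> measurable (LebT_prod N) (LebT_prod N)" if "a \<in> torus_box" for a :: "real^'d"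
    unfolding LebT_prod_def using that by (intro measurable_fun_upd[where J = "{..N}"]) auto
  have m: "(\<lambda>q. \<integral>\<^sup>+y. Q (y(0 := fst q, N := snd q)) \<partial>LebT_prod N) \<in> borel_measurable (LebT \<Otimes>\<^sub>M LebT)"
    using L.borel_measurable_nn_integral_fst[OF measurable_compose[OF measurable_fun_upd2_LebT_prod Q]]
    by simp
  have "(\<integral>\<^sup>+q. \<integral>\<^sup>+y. Q (y(0 := fst q, N := snd q)) \<partial>LebT_prod N \<partial>(LebT \<Otimes>\<^sub>M LebT)) =
      (\<integral>\<^sup>+a. \<integral>\<^sup>+b. \<integral>\<^sup>+y. Q (y(0 := a, N := b)) \<partial>LebT_prod N \<partial>LebT \<partial>LebT)"
    using LebT.nn_integral_fst[OF m] by simp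
  also have "\<dots> = (\<integral>\<^sup>+a. \<integral>\<^sup>+y. Q (y(0 := a)) \<partial>LebT_prod N \<partial>LebT)"
  proof (intro nn_integral_cong)
    fix a :: "real^'d" assume "a \<in> space LebT"
    then have "(\<lambda>y. Q (y(0 := a))) \<in> borel_measurable (LebT_prod N)"
      using upd[of a] Q by (auto intro: measurable_compose)
    from nn_integral_LebT_prod_resample[OF this order_refl]
    show "(\<integral>\<^sup>+b. \<integral>\<^sup>+y. Q (y(0 := a, N := b)) \<partial>LebT_prod N \<partial>LebT) = (\<integral>\<^sup>+y. Q (y(0 := a)) \<partial>LebT_prod N)"
      using N by (simp add: fun_upd_twist)
  qed
  also have "\<dots> = (\<integral>\<^sup>+y. Q y \<partial>LebT_prod N)"
    by (rule nn_integral_LebT_prod_resample[OF Q]) simp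
  finally show ?thesis .
qed

text \<open>There are at most N factors, each bounded by m^d, and 1 \<le> m allows the exponent to
  be raised to N.\<close>

lemma cell_weight_le:
  fixes x :: "nat \<Rightarrow> real^'d"
  assumes "1 \<le> m"
  shows "cell_weight N m x y \<le> (real m ^ CARD('d)) ^ N"
proof -
  have "cell_weight N m x y \<le> (\<Prod>i\<in>{1..<N}. real m ^ CARD('d))"
    unfolding cell_weight_def by (intro prod_mono conjI cell_kernel_nonneg cell_kernel_le)
  also have "\<dots> \<le> (real m ^ CARD('d)) ^ N"
    using assms by (simp add: power_increasing)
  finally show ?thesis .
qed

text \<open>Only the interior coordinates are smoothed, so the density of the smoothed plan is
  controlled by that of its endpoint marginal \<open>\<pi>\<close>.\<close>
lemma cell_smooth_dominated:
  fixes \<gamma> :: "(nat \<Rightarrow> real^'d) measure"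
  assumes \<gamma>: "\<gamma> \<in> GammaN N \<pi>" and N: "1 \<le> N" and m: "1 \<le> m"
    and p: "p \<in> borel_measurable (LebT \<Otimes>\<^sub>M LebT)" and \<pi>: "\<pi> = density (LebT \<Otimes>\<^sub>M LebT) p"
    and A: "A \<in> sets (LebT_prod N)"
  shows "emeasure (cell_smooth N m \<gamma>) A \<le>
    ennreal ((real m ^ CARD('d)) ^ N) * (\<integral>\<^sup>+z. p (z 0, z N) * indicator A z \<partial>LebT_prod N)"
proof -
  let ?M = "ennreal ((real m ^ CARD('d)) ^ N)"
  interpret L: prob_space "LebT_prod N :: (nat \<Rightarrow> real^'d) measure"
    by (rule prob_space_LebT_prod)
  have sets: "sets \<gamma> = sets (LebT_prod N)"
    and distr: "distr \<gamma> (LebT \<Otimes>\<^sub>M LebT) (\<lambda>x. (x 0, x N)) = \<pi>"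
    using \<gamma> by (auto simp: GammaN_def prob_torus_def)
  have sp: "space \<gamma> = space (LebT_prod N)"
    by (rule sets_eq_imp_space_eq[OF sets])
  have pair: "(\<lambda>x. (x 0, x N)) \<in> measurable (LebT_prod N) (LebT \<Otimes>\<^sub>M (LebT :: (real^'d) measure))"
    by (rule measurable_pair_LebT_prod) auto
  then have pair\<gamma>: "(\<lambda>x. (x 0, x N)) \<in> measurable \<gamma> (LebT \<Otimes>\<^sub>M (LebT :: (real^'d) measure))"
    by (simp cong: measurable_cong_sets add: sets)
  have merge': "cell_merge N \<in> measurable (\<gamma> \<Otimes>\<^sub>M LebT_prod N) (LebT_prod N)"
    by (rule measurable_cell_merge[OF sets])
  then have merge: "cell_merge N \<in> measurable (cell_joint N m \<gamma>) (LebT_prod N)"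
    by (simp cong: measurable_cong_sets add: sets_cell_joint)
  have Im: "(indicator A :: _ \<Rightarrow> ennreal) \<in> borel_measurable (LebT_prod N)"
    using A by simp
  have upd: "(\<lambda>q. indicator A ((snd q)(0 := fst (fst q), N := snd (fst q))) :: ennreal)
      \<in> borel_measurable ((LebT \<Otimes>\<^sub>M LebT) \<Otimes>\<^sub>M LebT_prod N)"
    by (rule measurable_compose[OF measurable_fun_upd2_LebT_prod Im])
  \<comment> \<open>The mass of A under the product measure with endpoints pinned at q. Once the
    weight is bounded by its maximum, what remains depends on x only through its endpoints, so the
    integral against \<open>\<gamma>\<close> becomes one against \<open>\<pi>\<close>.\<close>
  define H where "H q = (\<integral>\<^sup>+y. indicator A (y(0 := fst q, N := snd q)) \<partial>LebT_prod N)" for q :: "(real^'d) \<times> (real^'d)"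
  have H: "H \<in> borel_measurable (LebT \<Otimes>\<^sub>M LebT)"
    unfolding H_def[abs_def] using L.borel_measurable_nn_integral_fst[OF upd] by simp
  have Hy: "(\<lambda>y. indicator A (y(0 := fst q, N := snd q)) :: ennreal) \<in> borel_measurable (LebT_prod N)"
    if "q \<in> space (LebT \<Otimes>\<^sub>M LebT)" for q
    using measurable_compose[OF measurable_Pair1'[OF that] upd] by simp
  have "emeasure (cell_smooth N m \<gamma>) A = (\<integral>\<^sup>+z. indicator A z \<partial>cell_smooth N m \<gamma>)"
    using A by simp
  also have "\<dots> = (\<integral>\<^sup>+q. indicator A (cell_merge N q) \<partial>cell_joint N m \<gamma>)"
    unfolding cell_smooth_def by (rule nn_integral_distr[OF merge]) (use Im in simp)
  also have "\<dots> = (\<integral>\<^sup>+x. \<integral>\<^sup>+y. ennreal (cell_weight N m x y) * indicator A (cell_merge N (x, y)) \<partial>LebT_prod N \<partial>\<gamma>)"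
    by (rule nn_integral_cell_joint[OF sets measurable_compose[OF merge' Im]])
  also have "\<dots> \<le> (\<integral>\<^sup>+x. ?M * H (x 0, x N) \<partial>\<gamma>)"
  proof (intro nn_integral_mono)
    fix x assume x: "x \<in> space \<gamma>"
    then have q: "(x 0, x N) \<in> space (LebT \<Otimes>\<^sub>M LebT)"
      using measurable_space[OF pair\<gamma>] by simp
    have "(\<integral>\<^sup>+y. ennreal (cell_weight N m x y) * indicator A (cell_merge N (x, y)) \<partial>LebT_prod N)
       \<le> (\<integral>\<^sup>+y. ?M * indicator A (y(0 := x 0, N := x N)) \<partial>LebT_prod N)"
    proof (intro nn_integral_mono)
      fix y :: "nat \<Rightarrow> real^'d" assume "y \<in> space (LebT_prod N)"
      then have "cell_merge N (x, y) = y(0 := x 0, N := x N)"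
        by (auto simp: cell_merge_def fun_eq_iff space_LebT_prod PiE_def extensional_def)
      then show "ennreal (cell_weight N m x y) * indicator A (cell_merge N (x, y)) \<le> ?M * indicator A (y(0 := x 0, N := x N))"
        using cell_weight_le[OF m, of N x y] by (intro mult_mono ennreal_leI) auto
    qed
    also have "\<dots> = ?M * H (x 0, x N)"
      unfolding H_def using Hy[OF q] by (simp add: nn_integral_cmult)
    finally show "(\<integral>\<^sup>+y. ennreal (cell_weight N m x y) * indicator A (cell_merge N (x, y)) \<partial>LebT_prod N) \<le> ?M * H (x 0, x N)" .
  qed
  also have "\<dots> = ?M * (\<integral>\<^sup>+x. H (x 0, x N) \<partial>\<gamma>)"
    by (rule nn_integral_cmult[OF measurable_compose[OF pair\<gamma> H]])
  also have "(\<integral>\<^sup>+x. H (x 0, x N) \<partial>\<gamma>) = (\<integral>\<^sup>+q. H q \<partial>\<pi>)"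
    unfolding distr[symmetric] by (rule nn_integral_distr[OF pair\<gamma>, symmetric]) (simp add: H)
  also have "\<dots> = (\<integral>\<^sup>+q. p q * H q \<partial>(LebT \<Otimes>\<^sub>M LebT))"
    unfolding \<pi> by (rule nn_integral_density[OF p H])
  also have "\<dots> = (\<integral>\<^sup>+q. \<integral>\<^sup>+y. (\<lambda>z. p (z 0, z N) * indicator A z) (y(0 := fst q, N := snd q)) \<partial>LebT_prod N \<partial>(LebT \<Otimes>\<^sub>M LebT))"
    unfolding H_def using N Hy by (intro nn_integral_cong) (simp add: nn_integral_cmult)
  also have "\<dots> = (\<integral>\<^sup>+z. p (z 0, z N) * indicator A z \<partial>LebT_prod N)"
    using N by (intro nn_integral_LebT_prod_resample2 borel_measurable_times_ennreal measurable_compose[OF pair p] Im)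
  finally show ?thesis .
qed

text \<open>If the derivative exceeded g on a set of positive measure, integrating over that set
  would contradict the domination; finiteness of the integral of g makes the comparison
  strict.\<close>

lemma RN_deriv_le_of_dominated:
  fixes \<gamma> \<theta> :: "'a measure"
  assumes "sigma_finite_measure \<theta>" and sets: "sets \<gamma> = sets \<theta>"
    and g: "g \<in> borel_measurable \<theta>" and fin: "(\<integral>\<^sup>+x. g x \<partial>\<theta>) \<noteq> \<infinity>"
    and dom: "\<And>A. A \<in> sets \<theta> \<Longrightarrow> emeasure \<gamma> A \<le> (\<integral>\<^sup>+x. g x * indicator A x \<partial>\<theta>)"
  shows "absolutely_continuous \<theta> \<gamma>" "AE x in \<theta>. RN_deriv \<theta> \<gamma> x \<le> g x"
proof -
  interpret sigma_finite_measure \<theta> by fact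
  show ac: "absolutely_continuous \<theta> \<gamma>"
    unfolding absolutely_continuous_def
  proof
    fix A assume A: "A \<in> null_sets \<theta>"
    then have "(\<integral>\<^sup>+x. g x * indicator A x \<partial>\<theta>) = 0"
      by (rule nn_integral_null_set)
    with A dom[of A] show "A \<in> null_sets \<gamma>"
      by (auto simp: null_sets_def sets)
  qed
  define A where "A = {x \<in> space \<theta>. g x < RN_deriv \<theta> \<gamma> x}"
  have A[measurable]: "A \<in> sets \<theta>"
    unfolding A_def using g by measurable
  note g[measurable]
  show "AE x in \<theta>. RN_deriv \<theta> \<gamma> x \<le> g x"
  proof (rule ccontr)
    assume n: "\<not> ?thesis"
    have "(\<integral>\<^sup>+x. g x * indicator A x \<partial>\<theta>) < (\<integral>\<^sup>+x. RN_deriv \<theta> \<gamma> x * indicator A x \<partial>\<theta>)"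
    proof (rule nn_integral_less)
      have "(\<integral>\<^sup>+x. g x * indicator A x \<partial>\<theta>) \<le> (\<integral>\<^sup>+x. g x \<partial>\<theta>)"
        by (intro nn_integral_mono) (auto split: split_indicator)
      with fin show "(\<integral>\<^sup>+x. g x * indicator A x \<partial>\<theta>) \<noteq> \<infinity>"
        by (auto simp: top_unique)
      show "AE x in \<theta>. g x * indicator A x \<le> RN_deriv \<theta> \<gamma> x * indicator A x"
        by (auto simp: A_def split: split_indicator)
      show "\<not> (AE x in \<theta>. RN_deriv \<theta> \<gamma> x * indicator A x \<le> g x * indicator A x)"
      proof
        assume "AE x in \<theta>. RN_deriv \<theta> \<gamma> x * indicator A x \<le> g x * indicator A x"
        then have "AE x in \<theta>. RN_deriv \<theta> \<gamma> x \<le> g x"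
          using AE_space by eventually_elim (auto simp: A_def not_less split: split_indicator_asm)
        with n show False by simp
      qed
    qed measurable
    also have "\<dots> = emeasure (density \<theta> (RN_deriv \<theta> \<gamma>)) A"
      by (simp add: emeasure_density)
    also have "\<dots> = emeasure \<gamma> A"
      by (simp add: density_RN_deriv[OF ac sets])
    finally show False
      using dom[OF A] by simp
  qed
qed

text \<open>The subtracted integral is nonnegative, so a pointwise upper bound on the log density
  suffices for the limsup.\<close>

lemma rel_entropy_le_positive_part:
  assumes "absolutely_continuous \<theta> \<gamma>" "sets \<gamma> = sets \<theta>"
  shows "rel_entropy \<gamma> \<theta> \<le> enn2ereal (\<integral>\<^sup>+x. ennreal (ln (enn2real (RN_deriv \<theta> \<gamma> x))) \<partial>\<gamma>)"
  using assms by (auto simp: rel_entropy_def intro!: ereal_diff_le_self)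

text \<open>Meant for D the derivative of the smoothed plan, P the endpoint density and
  \<open>\<Theta>\<close> the density of \<open>theta\<close>. Conversion to \<open>ennreal\<close>
  truncates negative logarithms, which accounts for the positive part of ln P. If
  \<open>enn2real D = 0\<close>, then \<open>ln 0 = 0\<close> settles the claim.\<close>

lemma ln_enn2real_le:
  assumes "D \<le> ennreal M * P * ennreal (1 / \<Theta>)" "P \<noteq> \<infinity>" "1 \<le> M" "exp (- c) \<le> \<Theta>" "0 \<le> c"
  shows "ennreal (ln (enn2real D)) \<le> ennreal (ln M) + ennreal (ln (enn2real P)) + ennreal c"
proof (cases "enn2real D = 0")
  case False
  let ?D = "enn2real D" and ?P = "enn2real P"
  have \<Theta>: "0 < \<Theta>"
    using assms(4) less_le_trans[OF exp_gt_zero] by blast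
  have P: "P = ennreal ?P"
    using assms(2) by (simp add: less_top)
  have D: "0 < ?D"
    using False enn2real_nonneg[of D] by linarith
  have "D \<le> ennreal (M * ?P / \<Theta>)"
    using assms(1,3) \<Theta> by (subst (asm) P) (simp add: ennreal_mult'[symmetric])
  then have D_le: "?D \<le> M * ?P / \<Theta>"
    using assms(3) \<Theta> by (intro enn2real_leI) auto
  have "?P \<noteq> 0"
    using D D_le by auto
  then have Ppos: "0 < ?P"
    using enn2real_nonneg[of P] by linarith
  have "- c \<le> ln \<Theta>"
    using assms(4) \<Theta> by (simp add: ln_ge_iff)
  moreover have "ln ?D \<le> ln (M * ?P / \<Theta>)"
    using D D_le by simp
  moreover have "ln (M * ?P / \<Theta>) = ln M + ln ?P - ln \<Theta>"
    using assms(3) Ppos \<Theta> by (simp add: ln_div ln_mult)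
  ultimately have "ln ?D \<le> ln M + max 0 (ln ?P) + c"
    by linarith
  then have "ennreal (ln ?D) \<le> ennreal (ln M + max 0 (ln ?P) + c)"
    by (rule ennreal_leI)
  also have "\<dots> = ennreal (ln M) + ennreal (max 0 (ln ?P)) + ennreal c"
    using assms(3,5) by (simp add: ennreal_plus)
  finally show ?thesis
    by (simp add: ennreal_max_0)
qed simp

text \<open>The three summands come from the three factors of a dominating density: the cube kernels
  give ln M, the endpoint density gives the positive part of the entropy of \<open>\<pi>\<close>,
  and the heat-kernel lower bound gives c_N / \<epsilon>.\<close>

lemma rel_entropy_cell_smooth_le:
  fixes \<gamma> :: "(nat \<Rightarrow> real^'d) measure"
  assumes \<epsilon>: "0 < \<epsilon>" "0 < T" "1 \<le> N" "\<epsilon> * T / real N \<le> 1"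
    and \<gamma>: "\<gamma> \<in> GammaN N \<pi>" and m: "1 \<le> m"
    and "prob_space \<pi>" and sets_\<pi>: "sets \<pi> = sets (LebT \<Otimes>\<^sub>M LebT)"
    and ac: "absolutely_continuous (LebT \<Otimes>\<^sub>M LebT) \<pi>"
  shows "rel_entropy (cell_smooth N m \<gamma>) (theta N T \<epsilon>) \<le>
    enn2ereal (ennreal (ln ((real m ^ CARD('d)) ^ N))
      + (\<integral>\<^sup>+q. ennreal (ln (enn2real (RN_deriv (LebT \<Otimes>\<^sub>M LebT) \<pi> q))) \<partial>\<pi>)
      + ennreal ((\<integral>x. cN N T x \<partial>cell_smooth N m \<gamma>) / \<epsilon>))"
proof -
  let ?S = "cell_smooth N m \<gamma>" and ?L = "LebT_prod N :: (nat \<Rightarrow> real^'d) measure"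
    and ?\<theta> = "theta N T \<epsilon> :: (nat \<Rightarrow> real^'d) measure" and ?LL = "LebT \<Otimes>\<^sub>M LebT :: ((real^'d) \<times> (real^'d)) measure"
  define M where "M = (real m ^ CARD('d)) ^ N"
  define p where "p = RN_deriv ?LL \<pi>"
  have M: "1 \<le> M"
    using m by (simp add: M_def one_le_power)
  interpret \<pi>: prob_space \<pi> by fact
  interpret LL: pair_prob_space LebT "LebT :: (real^'d) measure" by unfold_locales
  interpret L: prob_space ?L
    by (rule prob_space_LebT_prod)
  interpret \<theta>: finite_measure ?\<theta>
    by (rule finite_measure_theta[OF \<epsilon>])
  have p[measurable]: "p \<in> borel_measurable ?LL"
    by (simp add: p_def)
  have \<pi>: "\<pi> = density ?LL p"
    unfolding p_def using LL.density_RN_deriv[OF ac sets_\<pi>] by simp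
  have S: "?S \<in> GammaN N \<pi>"
    by (rule cell_smooth_GammaN[OF \<gamma> m])
  then have S_prob: "?S \<in> prob_torus N" "prob_space ?S"
    and S_distr: "distr ?S ?LL (\<lambda>x. (x 0, x N)) = \<pi>"
    by (auto simp: GammaN_def prob_torus_def)
  interpret S: prob_space ?S by fact
  have pair[measurable]: "(\<lambda>x. (x 0, x N)) \<in> measurable ?L ?LL"
    by (rule measurable_pair_LebT_prod) auto
  then have pairS[measurable]: "(\<lambda>x. (x 0, x N)) \<in> measurable ?S ?LL"
    by (simp cong: measurable_cong_sets)
  note theta_dens_measurable[OF \<epsilon>, measurable]
  have \<Theta>: "0 < theta_dens N T \<epsilon> x" for x :: "nat \<Rightarrow> real^'d"
    using less_le_trans[OF exp_gt_zero theta_dens_lower[OF \<epsilon>]] .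
  \<comment> \<open>Dividing the bound of \<open>cell_smooth_dominated\<close> by the density of
    \<open>theta\<close> changes the reference measure from \<open>LebT_prod\<close> to
    \<open>theta\<close>.\<close>
  define g where "g x = ennreal M * p (x 0, x N) * ennreal (1 / theta_dens N T \<epsilon> x)" for x :: "nat \<Rightarrow> real^'d"
  have gL[measurable]: "g \<in> borel_measurable ?L"
    unfolding g_def by measurable
  then have g[measurable]: "g \<in> borel_measurable ?\<theta>"
    by (simp cong: measurable_cong_sets)
  have int_g: "(\<integral>\<^sup>+x. g x * indicator A x \<partial>?\<theta>) = ennreal M * (\<integral>\<^sup>+x. p (x 0, x N) * indicator A x \<partial>?L)"
    if [measurable]: "A \<in> sets ?L" for A
  proof -
    have "(\<integral>\<^sup>+x. g x * indicator A x \<partial>?\<theta>) =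
        (\<integral>\<^sup>+x. ennreal (theta_dens N T \<epsilon> x) * (g x * indicator A x) \<partial>?L)"
      unfolding theta_alt by (rule nn_integral_density) measurable
    also have "\<dots> = (\<integral>\<^sup>+x. ennreal M * (p (x 0, x N) * indicator A x) \<partial>?L)"
    proof (intro nn_integral_cong)
      fix x :: "nat \<Rightarrow> real^'d"
      have "ennreal (theta_dens N T \<epsilon> x) * (g x * indicator A x) =
          (ennreal (theta_dens N T \<epsilon> x) * ennreal (1 / theta_dens N T \<epsilon> x)) * (ennreal M * (p (x 0, x N) * indicator A x))"
        unfolding g_def by (simp only: mult_ac)
      also have "ennreal (theta_dens N T \<epsilon> x) * ennreal (1 / theta_dens N T \<epsilon> x) = 1"
        using \<Theta>[of x] by (simp add: ennreal_mult[symmetric])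
      finally show "ennreal (theta_dens N T \<epsilon> x) * (g x * indicator A x) = ennreal M * (p (x 0, x N) * indicator A x)"
        by simp
    qed
    also have "\<dots> = ennreal M * (\<integral>\<^sup>+x. p (x 0, x N) * indicator A x \<partial>?L)"
      by (rule nn_integral_cmult) measurable
    finally show ?thesis .
  qed
  \<comment> \<open>Normalisation of \<open>\<pi>\<close> makes the integral of g equal to M, hence
    finite as \<open>RN_deriv_le_of_dominated\<close> demands.\<close>
  have "(\<integral>\<^sup>+x. p (x 0, x N) \<partial>?L) = 1"
  proof -
    have "(\<integral>\<^sup>+x. p (x 0, x N) \<partial>?L) = (\<integral>\<^sup>+q. \<integral>\<^sup>+y. p q \<partial>?L \<partial>?LL)"
      using nn_integral_LebT_prod_resample2[OF measurable_compose[OF pair p] \<epsilon>(3)] \<epsilon>(3) by simp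
    also have "\<dots> = (\<integral>\<^sup>+q. p q \<partial>?LL)"
      by (simp add: L.emeasure_space_1)
    also have "\<dots> = emeasure (density ?LL p) (space ?LL)"
      by (subst emeasure_density) (auto intro!: nn_integral_cong)
    finally show ?thesis
      using \<pi>.emeasure_space_1 sets_eq_imp_space_eq[OF sets_\<pi>] by (simp add: \<pi>[symmetric])
  qed
  moreover have "(\<integral>\<^sup>+x. g x \<partial>?\<theta>) = (\<integral>\<^sup>+x. g x * indicator (space ?L) x \<partial>?\<theta>)"
    by (intro nn_integral_cong) simp
  moreover have "(\<integral>\<^sup>+x. p (x 0, x N) * indicator (space ?L) x \<partial>?L) = (\<integral>\<^sup>+x. p (x 0, x N) \<partial>?L)"
    by (intro nn_integral_cong) simp
  ultimately have fin: "(\<integral>\<^sup>+x. g x \<partial>?\<theta>) \<noteq> \<infinity>"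
    using int_g[OF sets.top] by simp
  have dom: "emeasure ?S A \<le> (\<integral>\<^sup>+x. g x * indicator A x \<partial>?\<theta>)" if "A \<in> sets ?\<theta>" for A
    using cell_smooth_dominated[OF \<gamma> \<epsilon>(3) m p \<pi>, of A] that int_g[of A] by (simp add: M_def)
  have setsS: "sets ?S = sets ?\<theta>"
    by simp
  note RN = RN_deriv_le_of_dominated[OF \<theta>.sigma_finite_measure_axioms setsS g fin dom]
  have "AE x in ?S. RN_deriv ?\<theta> ?S x \<le> g x"
    using absolutely_continuous_AE[OF setsS RN] .
  \<comment> \<open>\<open>enn2real\<close> sends \<infinity> to 0, so finiteness of p at the
    endpoints must be secured before taking logarithms.\<close>
  moreover have "AE x in ?S. p (x 0, x N) \<noteq> \<infinity>"
  proof -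
    have "AE q in ?LL. p q \<noteq> \<infinity>"
      unfolding p_def using LL.RN_deriv_finite[OF _ ac sets_\<pi>] \<pi>.sigma_finite_measure_axioms by simp
    then have "AE q in \<pi>. p q \<noteq> \<infinity>"
      by (rule absolutely_continuous_AE[OF sets_\<pi> ac])
    then have "AE q in distr ?S ?LL (\<lambda>x. (x 0, x N)). p q \<noteq> \<infinity>"
      unfolding S_distr .
    then show ?thesis
      by (rule AE_distrD[OF pairS])
  qed
  ultimately have "AE x in ?S. ennreal (ln (enn2real (RN_deriv ?\<theta> ?S x))) \<le>
      ennreal (ln M) + ennreal (ln (enn2real (p (x 0, x N)))) + ennreal (cN N T x / \<epsilon>)"
  proof eventually_elim
    case (elim x)
    show ?case
      using elim M theta_dens_lower[OF \<epsilon>, of x] \<epsilon> unfolding g_def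
      by (intro ln_enn2real_le[where \<Theta> = "theta_dens N T \<epsilon> x"]) (auto simp: cN_nonneg)
  qed
  then have "(\<integral>\<^sup>+x. ennreal (ln (enn2real (RN_deriv ?\<theta> ?S x))) \<partial>?S) \<le>
      (\<integral>\<^sup>+x. ennreal (ln M) + ennreal (ln (enn2real (p (x 0, x N)))) + ennreal (cN N T x / \<epsilon>) \<partial>?S)"
    by (rule nn_integral_mono_AE)
  also have "\<dots> = ennreal (ln M) + (\<integral>\<^sup>+x. ennreal (ln (enn2real (p (x 0, x N)))) \<partial>?S) + (\<integral>\<^sup>+x. ennreal (cN N T x / \<epsilon>) \<partial>?S)"
  proof -
    have [measurable]: "cN N T \<in> borel_measurable ?S"
      using measurable_torus_cont[OF cN_torus_cont, where 'd = 'd, of N] by (simp cong: measurable_cong_sets)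
    have [measurable]: "(\<lambda>x. p (x 0, x N)) \<in> borel_measurable ?S"
      by (rule measurable_compose[OF pairS p])
    show ?thesis
      by (simp add: nn_integral_add S.emeasure_space_1)
  qed
  also have "(\<integral>\<^sup>+x. ennreal (ln (enn2real (p (x 0, x N)))) \<partial>?S) = (\<integral>\<^sup>+q. ennreal (ln (enn2real (p q))) \<partial>\<pi>)"
    unfolding S_distr[symmetric] by (rule nn_integral_distr[OF pairS, symmetric]) measurable
  also have "(\<integral>\<^sup>+x. ennreal (cN N T x / \<epsilon>) \<partial>?S) = ennreal ((\<integral>x. cN N T x \<partial>?S) / \<epsilon>)"
  proof -
    have "integrable ?S (cN N T)"
      by (rule torus_cont_integrable[OF cN_torus_cont S_prob(1)])
    then show ?thesis
      using \<epsilon> by (subst nn_integral_eq_integral) (auto simp: cN_nonneg)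
  qed
  finally have "enn2ereal (\<integral>\<^sup>+x. ennreal (ln (enn2real (RN_deriv ?\<theta> ?S x))) \<partial>?S) \<le>
    enn2ereal (ennreal (ln M) + (\<integral>\<^sup>+q. ennreal (ln (enn2real (p q))) \<partial>\<pi>) + ennreal ((\<integral>x. cN N T x \<partial>?S) / \<epsilon>))"
    by (simp add: less_eq_ennreal.rep_eq)
  with rel_entropy_le_positive_part[OF RN(1) setsS] show ?thesis
    unfolding M_def p_def by (rule order_trans)
qed

subsection \<open>Gamma-convergence\<close>

text \<open>The heat-kernel estimates are stated for times at most 1; along the sequence this holds
  from some index on, which is enough for liminf and limsup.\<close>

lemma eventually_small_time:
  assumes "0 < T" "1 \<le> N" "\<And>n. 0 < e n" "e \<longlonglongrightarrow> 0"
  shows "\<forall>\<^sub>F n in sequentially. e n * T / real N \<le> 1"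
proof -
  have "(\<lambda>n. e n * T / real N) \<longlonglongrightarrow> 0 * T / real N"
    using assms by (intro tendsto_intros) auto
  then have "\<forall>\<^sub>F n in sequentially. e n * T / real N < 1"
    by (rule order_tendstoD) simp
  then show ?thesis
    by eventually_elim simp
qed

lemma JN_GammaN:
  assumes "0 < T" "\<gamma> \<in> GammaN N \<pi>"
  shows "JN N T \<pi> \<gamma> = ereal (\<integral>x. cN N T x \<partial>\<gamma>)"
proof -
  have "\<gamma> \<in> prob_torus N"
    using assms by (simp add: GammaN_def)
  then show ?thesis
    using assms
    by (simp add: JN_def chi_def nn_integral_cN enn2ereal_ennreal integral_nonneg_AE cN_nonneg)
qed

lemma weak_conv_torus_subseq:
  assumes "weak_conv_torus \<gamma>s \<gamma>" "strict_mono r"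
  shows "weak_conv_torus (\<lambda>n. \<gamma>s (r n)) \<gamma>"
  unfolding weak_conv_torus_def
proof (intro allI impI)
  fix f :: "(nat \<Rightarrow> real^'a) \<Rightarrow> real" assume "torus_cont f"
  with assms(1) have "(\<lambda>n. \<integral>x. f x \<partial>\<gamma>s n) \<longlonglongrightarrow> (\<integral>x. f x \<partial>\<gamma>)"
    by (simp add: weak_conv_torus_def)
  from LIMSEQ_subseq_LIMSEQ[OF this assms(2)]
  show "(\<lambda>n. \<integral>x. f x \<partial>\<gamma>s (r n)) \<longlonglongrightarrow> (\<integral>x. f x \<partial>\<gamma>)"
    by (simp add: comp_def)
qed

lemma JNeps_liminf:
  fixes \<gamma> :: "(nat \<Rightarrow> real^'d) measure"
  assumes T: "0 < T" and N: "1 \<le> N" and e: "\<And>n. 0 < e n" "e \<longlonglongrightarrow> 0"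
    and \<gamma>s: "\<And>n. \<gamma>s n \<in> prob_torus N" and \<gamma>: "\<gamma> \<in> prob_torus N" and conv: "weak_conv_torus \<gamma>s \<gamma>"
  shows "JN N T \<pi> \<gamma> \<le> liminf (\<lambda>n. JNeps N T \<pi> (e n) (\<gamma>s n))"
proof (cases "\<gamma> \<in> GammaN N \<pi>")
  case True
  define K where "K \<epsilon> = \<epsilon> * ln (heat_const TYPE('d) (\<epsilon> * T / real N) ^ N)" for \<epsilon>
  have "filterlim e (at_right 0) sequentially"
    using e by (intro tendsto_imp_filterlim_at_right) auto
  then have "(\<lambda>n. K (e n)) \<longlonglongrightarrow> 0"
    unfolding K_def by (rule filterlim_compose[OF heat_const_error_tendsto[OF T N]])
  moreover have "(\<lambda>n. \<integral>x. cN N T x \<partial>\<gamma>s n) \<longlonglongrightarrow> (\<integral>x. cN N T x \<partial>\<gamma>)"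
    using conv cN_torus_cont[of N T] by (auto simp: weak_conv_torus_def)
  ultimately have "(\<lambda>n. (\<integral>x. cN N T x \<partial>\<gamma>s n) - K (e n)) \<longlonglongrightarrow> (\<integral>x. cN N T x \<partial>\<gamma>) - 0"
    by (intro tendsto_diff)
  then have "(\<lambda>n. ereal ((\<integral>x. cN N T x \<partial>\<gamma>s n) - K (e n))) \<longlonglongrightarrow> ereal (\<integral>x. cN N T x \<partial>\<gamma>)"
    by simp
  then have "ereal (\<integral>x. cN N T x \<partial>\<gamma>) = liminf (\<lambda>n. ereal ((\<integral>x. cN N T x \<partial>\<gamma>s n) - K (e n)))"
    by (intro lim_imp_Liminf[symmetric]) auto
  also have "\<dots> \<le> liminf (\<lambda>n. JNeps N T \<pi> (e n) (\<gamma>s n))"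
    using eventually_small_time[OF T N e]
    by (intro Liminf_mono) (auto elim!: eventually_mono intro: JNeps_ge[OF e(1) T N _ \<gamma>s] simp: K_def)
  finally show ?thesis
    by (simp add: JN_GammaN[OF T True])
next
  case False
  \<comment> \<open>Otherwise infinitely many terms satisfy the constraint, and closedness applied
    to that subsequence puts the limit into the constraint set.\<close>
  have "\<forall>\<^sub>F n in sequentially. \<gamma>s n \<notin> GammaN N \<pi>"
  proof (rule ccontr)
    assume "\<not> ?thesis"
    then have "infinite {n. \<gamma>s n \<in> GammaN N \<pi>}"
      by (simp add: cofinite_eq_sequentially[symmetric] eventually_cofinite)
    then obtain r :: "nat \<Rightarrow> nat" where r: "strict_mono r" "\<And>n. r n \<in> {n. \<gamma>s n \<in> GammaN N \<pi>}"
      using infinite_enumerate by blast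
    then have "\<gamma> \<in> GammaN N \<pi>"
      by (intro GammaN_weakly_closed[OF _ \<gamma> weak_conv_torus_subseq[OF conv]]) auto
    with False show False by simp
  qed
  then have "\<forall>\<^sub>F n in sequentially. \<infinity> \<le> JNeps N T \<pi> (e n) (\<gamma>s n)"
    by eventually_elim (simp add: JNeps_def chi_def)
  then have "liminf (\<lambda>n. \<infinity>) \<le> liminf (\<lambda>n. JNeps N T \<pi> (e n) (\<gamma>s n))"
    by (rule Liminf_mono)
  then show ?thesis
    by (simp add: Liminf_const)
qed

text \<open>The choice of m balances two needs: m tends to infinity, for weak convergence, while
  \<epsilon> ln m \<le> \<epsilon> m \<le> \<epsilon> (\<epsilon>^(-1/2) + 1) tends to 0, for the
  entropy cost. The cost term converges because c_N is itself a test function.\<close>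

lemma JNeps_recovery:
  fixes \<gamma> :: "(nat \<Rightarrow> real^'d) measure"
  assumes T: "0 < T" and N: "1 \<le> N" and e: "\<And>n. 0 < e n" "e \<longlonglongrightarrow> 0"
    and "prob_space \<pi>" and sets_\<pi>: "sets \<pi> = sets (LebT \<Otimes>\<^sub>M LebT)"
    and ent: "rel_entropy \<pi> (LebT \<Otimes>\<^sub>M LebT) < \<infinity>"
    and \<gamma>: "\<gamma> \<in> GammaN N \<pi>"
  defines "m \<equiv> \<lambda>n. nat \<lceil>1 / sqrt (e n)\<rceil>"
  shows "weak_conv_torus (\<lambda>n. cell_smooth N (m n) \<gamma>) \<gamma>"
    and "limsup (\<lambda>n. JNeps N T \<pi> (e n) (cell_smooth N (m n) \<gamma>)) \<le> JN N T \<pi> \<gamma>"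
    and "\<And>n. cell_smooth N (m n) \<gamma> \<in> prob_torus N"
proof -
  have \<gamma>P: "\<gamma> \<in> prob_torus N"
    using \<gamma> by (simp add: GammaN_def)
  have m1: "1 \<le> m n" for n
  proof -
    have "0 < 1 / sqrt (e n)"
      using e(1) by simp
    then show ?thesis
      unfolding m_def by linarith
  qed
  have m_ge: "1 / sqrt (e n) \<le> real (m n)" and m_le: "real (m n) \<le> 1 / sqrt (e n) + 1" for n
  proof -
    have "0 < 1 / sqrt (e n)"
      using e(1) by simp
    then show "1 / sqrt (e n) \<le> real (m n)" "real (m n) \<le> 1 / sqrt (e n) + 1"
      unfolding m_def by linarith+
  qed
  have er: "filterlim e (at_right 0) sequentially"
    using e by (intro tendsto_imp_filterlim_at_right) auto
  have "filterlim (\<lambda>x::real. 1 / sqrt x) at_top (at_right 0)"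
    by real_asymp
  from filterlim_compose[OF this er] have "filterlim (\<lambda>n. real (m n)) at_top sequentially"
    by (rule filterlim_at_top_mono) (simp add: m_ge)
  then have "\<forall>\<^sub>F n in sequentially. real Z \<le> real (m n)" for Z
    unfolding filterlim_at_top by blast
  then have m_top: "filterlim m at_top sequentially"
    unfolding filterlim_at_top of_nat_le_iff by blast
  show conv: "weak_conv_torus (\<lambda>n. cell_smooth N (m n) \<gamma>) \<gamma>"
    by (rule cell_smooth_weak_conv[OF \<gamma>P m1 m_top])
  have S: "cell_smooth N (m n) \<gamma> \<in> GammaN N \<pi>" for n
    by (rule cell_smooth_GammaN[OF \<gamma> m1])
  then show SP: "cell_smooth N (m n) \<gamma> \<in> prob_torus N" for n
    by (simp add: GammaN_def)
  have ac: "absolutely_continuous (LebT \<Otimes>\<^sub>M LebT) \<pi>"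
    using ent by (auto simp: rel_entropy_def split: if_splits)
  \<comment> \<open>Extended-real subtraction gives \<infinity> - x = \<infinity> for every x, so
    finite entropy forces a finite positive part.\<close>
  have "(\<integral>\<^sup>+q. ennreal (ln (enn2real (RN_deriv (LebT \<Otimes>\<^sub>M LebT) \<pi> q))) \<partial>\<pi>) \<noteq> \<infinity>"
    using ent ac sets_\<pi> by (auto simp: rel_entropy_def)
  then obtain a where a: "0 \<le> a" "(\<integral>\<^sup>+q. ennreal (ln (enn2real (RN_deriv (LebT \<Otimes>\<^sub>M LebT) \<pi> q))) \<partial>\<pi>) = ennreal a"
    by (auto elim: ennreal_cases)
  define u where "u n = e n * (real N * real CARD('d) * ln (real (m n)) + a) + (\<integral>x. cN N T x \<partial>cell_smooth N (m n) \<gamma>)" for n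
  have bound: "JNeps N T \<pi> (e n) (cell_smooth N (m n) \<gamma>) \<le> ereal (u n)" if small: "e n * T / real N \<le> 1" for n
  proof -
    let ?S = "cell_smooth N (m n) \<gamma>"
    have c: "0 \<le> (\<integral>x. cN N T x \<partial>?S)"
      using T by (intro integral_nonneg_AE) (simp add: cN_nonneg)
    have M: "1 \<le> (real (m n) ^ CARD('d)) ^ N"
      using m1[of n] by (simp add: one_le_power)
    have lnM: "ln ((real (m n) ^ CARD('d)) ^ N) = real N * real CARD('d) * ln (real (m n))"
      using m1[of n] by (simp add: ln_realpow)
    have "JNeps N T \<pi> (e n) ?S = ereal (e n) * rel_entropy ?S (theta N T (e n))"
      using S[of n] by (simp add: JNeps_def chi_def)
    also have "\<dots> \<le> ereal (e n) * enn2ereal (ennreal (ln ((real (m n) ^ CARD('d)) ^ N)) + ennreal a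
      + ennreal ((\<integral>x. cN N T x \<partial>?S) / e n))"
      using rel_entropy_cell_smooth_le[OF e(1) T N small \<gamma> m1 \<open>prob_space \<pi>\<close> sets_\<pi> ac] e(1)[of n]
      unfolding a(2) by (intro ereal_mult_left_mono) (auto simp: less_imp_le)
    also have "ennreal (ln ((real (m n) ^ CARD('d)) ^ N)) + ennreal a + ennreal ((\<integral>x. cN N T x \<partial>?S) / e n) =
        ennreal (ln ((real (m n) ^ CARD('d)) ^ N) + a + (\<integral>x. cN N T x \<partial>?S) / e n)"
      using M a(1) c e(1)[of n] by (simp add: ennreal_plus[symmetric] del: ennreal_plus)
    also have "enn2ereal \<dots> = ereal (ln ((real (m n) ^ CARD('d)) ^ N) + a + (\<integral>x. cN N T x \<partial>?S) / e n)"
      using M a(1) c e(1)[of n] by (intro enn2ereal_ennreal add_nonneg_nonneg) auto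
    finally show ?thesis
      using e(1)[of n] unfolding lnM u_def by (simp add: distrib_left)
  qed
  have em: "(\<lambda>n. e n * real (m n)) \<longlonglongrightarrow> 0"
  proof (rule tendsto_sandwich[OF _ _ tendsto_const])
    show "\<forall>\<^sub>F n in sequentially. 0 \<le> e n * real (m n)"
      using e(1) by (intro always_eventually allI mult_nonneg_nonneg) (auto simp: less_imp_le)
    show "\<forall>\<^sub>F n in sequentially. e n * real (m n) \<le> e n * (1 / sqrt (e n) + 1)"
      using e(1) m_le by (intro always_eventually allI mult_left_mono) (auto simp: less_imp_le)
    have "((\<lambda>x::real. x * (1 / sqrt x + 1)) \<longlongrightarrow> 0) (at_right 0)"
      by real_asymp
    from filterlim_compose[OF this er] show "(\<lambda>n. e n * (1 / sqrt (e n) + 1)) \<longlonglongrightarrow> 0" .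
  qed
  have eln: "(\<lambda>n. e n * ln (real (m n))) \<longlonglongrightarrow> 0"
  proof (rule tendsto_sandwich[OF _ _ tendsto_const em])
    show "\<forall>\<^sub>F n in sequentially. 0 \<le> e n * ln (real (m n))"
      using e(1) m1 by (intro always_eventually allI mult_nonneg_nonneg) (auto simp: less_imp_le)
    show "\<forall>\<^sub>F n in sequentially. e n * ln (real (m n)) \<le> e n * real (m n)"
      using e(1) m1 by (intro always_eventually allI mult_left_mono ln_bound)
        (auto simp: less_imp_le Suc_le_eq)
  qed
  have "(\<lambda>n. \<integral>x. cN N T x \<partial>cell_smooth N (m n) \<gamma>) \<longlonglongrightarrow> (\<integral>x. cN N T x \<partial>\<gamma>)"
    using conv cN_torus_cont[of N T] by (auto simp: weak_conv_torus_def)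
  then have "(\<lambda>n. real N * real CARD('d) * (e n * ln (real (m n))) + e n * a + (\<integral>x. cN N T x \<partial>cell_smooth N (m n) \<gamma>))
      \<longlonglongrightarrow> real N * real CARD('d) * 0 + 0 * a + (\<integral>x. cN N T x \<partial>\<gamma>)"
    by (intro tendsto_intros eln e)
  moreover have "u = (\<lambda>n. real N * real CARD('d) * (e n * ln (real (m n))) + e n * a + (\<integral>x. cN N T x \<partial>cell_smooth N (m n) \<gamma>))"
    by (simp add: u_def fun_eq_iff algebra_simps)
  ultimately have "(\<lambda>n. ereal (u n)) \<longlonglongrightarrow> ereal (\<integral>x. cN N T x \<partial>\<gamma>)"
    by simp
  then have "limsup (\<lambda>n. ereal (u n)) = ereal (\<integral>x. cN N T x \<partial>\<gamma>)"
    by (intro lim_imp_Limsup) auto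
  moreover have "limsup (\<lambda>n. JNeps N T \<pi> (e n) (cell_smooth N (m n) \<gamma>)) \<le> limsup (\<lambda>n. ereal (u n))"
    using eventually_small_time[OF T N e] by (intro Limsup_mono) (auto elim!: eventually_mono intro: bound)
  ultimately show "limsup (\<lambda>n. JNeps N T \<pi> (e n) (cell_smooth N (m n) \<gamma>)) \<le> JN N T \<pi> \<gamma>"
    by (simp add: JN_GammaN[OF T \<gamma>])
qed

theorem theorem4p3:
  fixes T :: real and N :: nat and \<pi> :: "((real^'d) \<times> (real^'d)) measure"
  assumes "T > 0" and "N \<ge> 1"
    and "prob_space \<pi>" and "sets \<pi> = sets (LebT \<Otimes>\<^sub>M LebT)"
    and "distr \<pi> LebT fst = LebT" and "distr \<pi> LebT snd = LebT"
    and "rel_entropy \<pi> (LebT \<Otimes>\<^sub>M LebT) < \<infinity>"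
  shows "gamma_converges (prob_torus N) weak_conv_torus (JNeps N T \<pi>) (JN N T \<pi>)"
  unfolding gamma_converges_def
proof (intro conjI allI impI; elim conjE)
  fix e :: "nat \<Rightarrow> real" and \<gamma>s and \<gamma> :: "(nat \<Rightarrow> real^'d) measure"
  assume "\<forall>n. 0 < e n" "e \<longlonglongrightarrow> 0" "\<forall>n. \<gamma>s n \<in> prob_torus N" "\<gamma> \<in> prob_torus N" "weak_conv_torus \<gamma>s \<gamma>"
  then show "JN N T \<pi> \<gamma> \<le> liminf (\<lambda>n. JNeps N T \<pi> (e n) (\<gamma>s n))"
    using assms(1,2) by (intro JNeps_liminf) auto
next
  fix e :: "nat \<Rightarrow> real" and \<gamma> :: "(nat \<Rightarrow> real^'d) measure"
  assume e: "\<forall>n. 0 < e n" "e \<longlonglongrightarrow> 0" and \<gamma>: "\<gamma> \<in> prob_torus N"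
  show "\<exists>xs. (\<forall>n. xs n \<in> prob_torus N) \<and> weak_conv_torus xs \<gamma> \<and>
      limsup (\<lambda>n. JNeps N T \<pi> (e n) (xs n)) \<le> JN N T \<pi> \<gamma>"
  proof (cases "\<gamma> \<in> GammaN N \<pi>")
    case True
    note rec = JNeps_recovery[OF assms(1,2) spec[OF e(1)] e(2) assms(3,4,7) True]
    show ?thesis
      by (intro exI[of _ "\<lambda>n. cell_smooth N (nat \<lceil>1 / sqrt (e n)\<rceil>) \<gamma>"] conjI allI rec)
  next
    case False
    then have "JN N T \<pi> \<gamma> = \<infinity>"
      by (simp add: JN_def chi_def)
    then show ?thesis
      using \<gamma> by (intro exI[of _ "\<lambda>_. \<gamma>"]) (simp add: weak_conv_torus_def)
  qed
qed

end
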